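(* For every object $U$ of $\mathrm{TKK}$, the truncated homology $H_\bullet(\mathrm{Ass}^{\mathrm{TKK}}(U))^{\mathrm{TKK}}$ vanishes in each degree greater than one.
   Context: We work over a field $k$ of characteristic zero. For $n\ge 0$, $L(n)$ denotes the irreducible $\mathfrak{sl}_2$-module of highest weight $n$. The category $\mathrm{TKK}$ has as objects the completely reducible $\mathfrak{sl}_2$-modules that are direct sums of copies of the trivial module $L(0)$ and the adjoint module $L(2)$, and as morphisms $\mathfrak{sl}_2$-module maps. $\mathrm{Ass}^{\mathrm{TKK}}(U)$ is the free unital associative algebra in $\mathrm{TKK}$ generated by $U$, i.e. the quotient of the tensor algebra $T(U)$ by the ideal generated by all $\mathfrak{sl}_2$-isotypic components $L(m)$ with $m\ne 0,2$; it is augmented with a natural $\mathfrak{sl}_2$-action. For an augmented associative algebra $R$, $H_\bullet(R)$ is the homology of its bar construction, i.e. $\mathrm{Tor}^R_\bullet(k,k)$, with the induced $\mathfrak{sl}_2$-action. For an $\mathfrak{sl}_2$-module $M$, $M^{\mathrm{TKK}}$ denotes its truncation: the quotient of $M$ by all irreducible $\mathfrak{sl}_2$-submodules different from $L(0)$ and $L(2)$. *)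

theory Defs
  imports Main
begin

(* Concrete model. sl2 basis e,h,f; an object U of TKK is (up to iso)
   L(0)^(I) (+) L(2)^(J); we use the basis Tr i (i in I) of the trivial
   summands and Ad j AE/AH/AF (j in J) (= e,h,f) of the adjoint summands.
   Vectors are finitely supported functions from a basis set to k. *)

datatype sl2 = SE | SH | SF
datatype adjb = AE | AH | AF
datatype ('i,'j) gen = Tr 'i | Ad 'j adjb

definition gens :: "'i set \<Rightarrow> 'j set \<Rightarrow> ('i,'j) gen set" where
  "gens I J = Tr ` I \<union> {Ad j a | j a. j \<in> J}"

definition single :: "'b \<Rightarrow> 'k::zero \<Rightarrow> 'b \<Rightarrow> 'k" where
  "single b c = (\<lambda>b'. if b' = b then c else 0)"

fun gen_act :: "sl2 \<Rightarrow> ('i,'j) gen \<Rightarrow> ('i,'j) gen \<Rightarrow> 'k::comm_ring_1" where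
  "gen_act x (Tr i) = (\<lambda>_. 0)"
| "gen_act SE (Ad j AE) = (\<lambda>_. 0)"
| "gen_act SE (Ad j AH) = single (Ad j AE) (-2)"
| "gen_act SE (Ad j AF) = single (Ad j AH) 1"
| "gen_act SH (Ad j AE) = single (Ad j AE) 2"
| "gen_act SH (Ad j AH) = (\<lambda>_. 0)"
| "gen_act SH (Ad j AF) = single (Ad j AF) (-2)"
| "gen_act SF (Ad j AE) = single (Ad j AH) (-1)"
| "gen_act SF (Ad j AH) = single (Ad j AF) 2"
| "gen_act SF (Ad j AF) = (\<lambda>_. 0)"

definition fin_supp :: "('b \<Rightarrow> 'k::zero) \<Rightarrow> bool" where
  "fin_supp f \<longleftrightarrow> finite {b. f b \<noteq> 0}"

definition lin :: "('a \<Rightarrow> 'b \<Rightarrow> 'k::comm_ring_1) \<Rightarrow> ('a \<Rightarrow> 'k) \<Rightarrow> 'b \<Rightarrow> 'k" where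
  "lin \<phi> v = (\<lambda>b. \<Sum>a\<in>{a. v a \<noteq> 0}. v a * \<phi> a b)"

(* action on a word (tensor monomial): derivation *)
definition word_act :: "sl2 \<Rightarrow> ('i,'j) gen list \<Rightarrow> ('i,'j) gen list \<Rightarrow> 'k::comm_ring_1" where
  "word_act x w w' = (\<Sum>j<length w. if w' = w[j := w' ! j] then gen_act x (w ! j) (w' ! j) else 0)"

(* action on a tuple of words (basis of T_+(U)^{tensor n}) *)
definition tup_act :: "sl2 \<Rightarrow> ('i,'j) gen list list \<Rightarrow> ('i,'j) gen list list \<Rightarrow> 'k::comm_ring_1" where
  "tup_act x t t' = (\<Sum>i<length t. if t' = t[i := t' ! i] then word_act x (t ! i) (t' ! i) else 0)"

definition fspan :: "('b \<Rightarrow> 'k::comm_ring_1) set \<Rightarrow> ('b \<Rightarrow> 'k) set" where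
  "fspan S = {v. \<exists>F c. finite F \<and> F \<subseteq> S \<and> v = (\<lambda>b. \<Sum>u\<in>F. c u * u b)}"

definition subsp :: "('b \<Rightarrow> 'k::comm_ring_1) set \<Rightarrow> bool" where
  "subsp S \<longleftrightarrow> (\<lambda>_. 0) \<in> S \<and> (\<forall>u\<in>S. \<forall>v\<in>S. (\<lambda>b. u b + v b) \<in> S)
     \<and> (\<forall>c. \<forall>v\<in>S. (\<lambda>b. c * v b) \<in> S)"

definition stable :: "(sl2 \<Rightarrow> ('b \<Rightarrow> 'k) \<Rightarrow> ('b \<Rightarrow> 'k)) \<Rightarrow> ('b \<Rightarrow> 'k) set \<Rightarrow> bool" where
  "stable \<rho> S \<longleftrightarrow> (\<forall>x. \<forall>v\<in>S. \<rho> x v \<in> S)"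

(* Module M = Z / Bd (Bd \<subseteq> Z subspaces stable under rho).
   is_Lcopy: w 0..w m (taken mod Bd) is the image of the standard basis
   v_i = f^i v_0 of L(m) under an injective sl2-map L(m) \<rightarrow> M. *)
definition is_Lcopy :: "(sl2 \<Rightarrow> ('b \<Rightarrow> 'k) \<Rightarrow> ('b \<Rightarrow> 'k)) \<Rightarrow> ('b \<Rightarrow> 'k::field) set
    \<Rightarrow> ('b \<Rightarrow> 'k) set \<Rightarrow> nat \<Rightarrow> (nat \<Rightarrow> 'b \<Rightarrow> 'k) \<Rightarrow> bool" where
  "is_Lcopy \<rho> Z Bd m w \<longleftrightarrow>
     (\<forall>i\<le>m. w i \<in> Z) \<and>
     (\<forall>c. (\<lambda>b. \<Sum>i\<le>m. c i * w i b) \<in> Bd \<longrightarrow> (\<forall>i\<le>m. c i = 0)) \<and>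
     (\<forall>i\<le>m. (\<lambda>b. \<rho> SH (w i) b - (of_nat m - 2 * of_nat i) * w i b) \<in> Bd) \<and>
     (\<forall>i<m. (\<lambda>b. \<rho> SF (w i) b - w (Suc i) b) \<in> Bd) \<and> \<rho> SF (w m) \<in> Bd \<and>
     \<rho> SE (w 0) \<in> Bd \<and>
     (\<forall>i. 1 \<le> i \<and> i \<le> m \<longrightarrow>
        (\<lambda>b. \<rho> SE (w i) b - of_nat (i * (m + 1 - i)) * w (i - 1) b) \<in> Bd)"

(* submodules of Z/Bd correspond to stable subspaces N with Bd \<subseteq> N \<subseteq> Z *)
definition is_submod where
  "is_submod \<rho> Z Bd N \<longleftrightarrow> subsp N \<and> stable \<rho> N \<and> Bd \<subseteq> N \<and> N \<subseteq> Z"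

definition irred_submod where
  "irred_submod \<rho> Z Bd N \<longleftrightarrow> is_submod \<rho> Z Bd N \<and> N \<noteq> Bd \<and>
     (\<forall>P. is_submod \<rho> Z Bd P \<and> P \<subseteq> N \<longrightarrow> P = Bd \<or> P = N)"

definition submod_iso_L where
  "submod_iso_L \<rho> Z Bd N m \<longleftrightarrow> (\<exists>w. is_Lcopy \<rho> Z Bd m w \<and> N = fspan (Bd \<union> w ` {..m}))"

(* the TKK-truncation of Z/Bd vanishes: Z/Bd is the sum of its irreducible
   submodules not isomorphic to L(0) or L(2) *)
definition trunc_zero where
  "trunc_zero \<rho> Z Bd \<longleftrightarrow>
     Z \<subseteq> fspan (Bd \<union> \<Union>{N. irred_submod \<rho> Z Bd N \<and> \<not> submod_iso_L \<rho> Z Bd N 0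
                                \<and> \<not> submod_iso_L \<rho> Z Bd N 2})"

definition TU :: "'i set \<Rightarrow> 'j set \<Rightarrow> (('i,'j) gen list \<Rightarrow> 'k::field) set" where
  "TU I J = {f. fin_supp f \<and> (\<forall>w. f w \<noteq> 0 \<longrightarrow> set w \<subseteq> gens I J)}"

definition isogen :: "'i set \<Rightarrow> 'j set \<Rightarrow> (('i,'j) gen list \<Rightarrow> 'k::field) set" where
  "isogen I J = {v. \<exists>m w. m \<noteq> 0 \<and> m \<noteq> 2 \<and>
      is_Lcopy (\<lambda>x. lin (word_act x)) (TU I J) {\<lambda>_. 0} m w \<and> v \<in> fspan (w ` {..m})}"

(* u * g * u' for words u, u' *)
definition shift :: "'g list \<Rightarrow> 'g list \<Rightarrow> ('g list \<Rightarrow> 'k::zero) \<Rightarrow> 'g list \<Rightarrow> 'k" where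
  "shift u u' g = (\<lambda>w. if length u + length u' \<le> length w \<and> take (length u) w = u
       \<and> drop (length w - length u') w = u'
     then g (drop (length u) (take (length w - length u') w)) else 0)"

definition ideal_I :: "'i set \<Rightarrow> 'j set \<Rightarrow> (('i,'j) gen list \<Rightarrow> 'k::field) set" where
  "ideal_I I J = fspan {shift u u' g | u u' g.
      set u \<subseteq> gens I J \<and> set u' \<subseteq> gens I J \<and> g \<in> isogen I J}"

(* basis of T_+(U)^{tensor n}: n-tuples of nonempty words *)
definition tuples :: "'i set \<Rightarrow> 'j set \<Rightarrow> nat \<Rightarrow> ('i,'j) gen list list set" where
  "tuples I J n = {t. length t = n \<and> (\<forall>s\<in>set t. s \<noteq> [] \<and> set s \<subseteq> gens I J)}"

definition Bsp :: "'i set \<Rightarrow> 'j set \<Rightarrow> nat \<Rightarrow> (('i,'j) gen list list \<Rightarrow> 'k::field) set" where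
  "Bsp I J n = {f. fin_supp f \<and> (\<forall>t. f t \<noteq> 0 \<longrightarrow> t \<in> tuples I J n)}"

(* u_0 | ... | g (slot i) | ... | u_{n-1} *)
definition slot :: "nat \<Rightarrow> 'g list list \<Rightarrow> ('g list \<Rightarrow> 'k::zero) \<Rightarrow> 'g list list \<Rightarrow> 'k" where
  "slot i u g = (\<lambda>t. if length t = length u \<and> t ! i \<noteq> []
       \<and> (\<forall>k<length u. k \<noteq> i \<longrightarrow> t ! k = u ! k) then g (t ! i) else 0)"

(* kernel of T_+^{tensor n} \<rightarrow> R_+^{tensor n}, R = Ass^TKK(U) = T(U)/I *)
definition Jsp :: "'i set \<Rightarrow> 'j set \<Rightarrow> nat \<Rightarrow> (('i,'j) gen list list \<Rightarrow> 'k::field) set" where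
  "Jsp I J n = fspan {slot i u g | i u g. i < n \<and> u \<in> tuples I J n \<and> g \<in> ideal_I I J}"

definition merge :: "nat \<Rightarrow> 'g list list \<Rightarrow> 'g list list" where
  "merge i t = take i t @ [t ! i @ t ! Suc i] @ drop (i + 2) t"

definition bar_d :: "'g list list \<Rightarrow> 'g list list \<Rightarrow> 'k::comm_ring_1" where
  "bar_d t = (\<lambda>t'. \<Sum>i\<in>{i. Suc i < length t}. if t' = merge i t then (-1) ^ i else 0)"

(* cycles and boundaries of the bar complex of R, represented in T_+^{tensor n} *)
definition Zc :: "'i set \<Rightarrow> 'j set \<Rightarrow> nat \<Rightarrow> (('i,'j) gen list list \<Rightarrow> 'k::field) set" where
  "Zc I J n = {z \<in> Bsp I J n. lin bar_d z \<in> Jsp I J (n - 1)}"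

definition Bc :: "'i set \<Rightarrow> 'j set \<Rightarrow> nat \<Rightarrow> (('i,'j) gen list list \<Rightarrow> 'k::field) set" where
  "Bc I J n = fspan (Jsp I J n \<union> lin bar_d ` Bsp I J (Suc n))"

end

theory Submission
  imports Defs
begin

text \<open>Associate to a word in the generators its type (the letters with the basis elements e, h, f of
  the adjoint summands forgotten) and the product of the corresponding 2 by 2 matrices. The ideal is
  the kernel of this map: it is generated by the copies of L(4) spanned by x a y, where x, y are
  adjoint and a is a word in trivial letters, and for the order f < h < e these relations form a
  Groebner basis whose normal words have adjoint letters f?h*e?. A discrete Morse matching on the bar
  complex leaves only chains of blocks (trivial letters followed by one adjoint letter) whose
  adjoint letters read e..ef..f or e..ehf..f. For n blocks with fixed types there is one such chain
  in each of the weights 2n, 2n-2, ..., -2n, and each is the critical term of exactly one of the cycles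
  obtained from the highest weight vector e|e|...|e by applying F. Hence the n-th homology is a sum
  of copies of L(2n) for n > 1, and L(2n) is neither L(0) nor L(2).\<close>

section \<open>Finitely supported functions\<close>

text \<open>The argument is dual. A functional is an arbitrary function on the basis words or
  tuples, and vectors of the quotient are tested by the functionals that satisfy the relations
  (\<open>Rel\<close>, \<open>RelT\<close>): \<open>Jsp_eq\<close> identifies \<open>Jsp\<close>
  with their common kernel in \<open>Bsp\<close>. Stability of \<open>Jsp\<close> under the action
  and the differential then follows from the transposed operators. The ideal is defined by all L(m)
  other than L(0) and L(2), so the L(4) relations must be shown to suffice; the link is the weight.
  Rewriting preserves it and normal words have weight -2, 0 or 2, so these functionals vanish on
  highest weight vectors of any other weight. Independence of the normal words comes from explicit
  dual functionals, the matrix entries, instead of resolving overlaps. The homology is only bounded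
  from above: modulo boundaries every cycle is a combination of vectors
  \<open>fl (tauL sk d)\<close>, and whether their classes vanish is left open, since a zero class
  does no harm to the truncation. Characteristic zero is used to divide by d + 1 and by factorials
  along the strings of L(2n), and to compare weights in the field.\<close>

lemma fspan_superset: "S \<subseteq> fspan S"
proof
  fix u assume "u \<in> S"
  then show "u \<in> fspan S" unfolding fspan_def
    by (intro CollectI exI[of _ "{u}"] exI[of _ "\<lambda>_. 1"]) simp
qed

lemma subsp_fspan: "subsp (fspan (S :: ('b \<Rightarrow> 'k::comm_ring_1) set))"
proof -
  have z: "(\<lambda>_. 0) \<in> fspan S"
    unfolding fspan_def by (intro CollectI exI[of _ "{}"]) auto
  have a: "(\<lambda>b. u b + v b) \<in> fspan S" if u: "u \<in> fspan S" and v: "v \<in> fspan S"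
    for u v :: "'b \<Rightarrow> 'k"
  proof -
    obtain F c where F: "finite F" "F \<subseteq> S" "u = (\<lambda>b. \<Sum>w\<in>F. c w * w b)"
      using u unfolding fspan_def by auto
    obtain G d where G: "finite G" "G \<subseteq> S" "v = (\<lambda>b. \<Sum>w\<in>G. d w * w b)"
      using v unfolding fspan_def by auto
    have 1: "(\<Sum>w\<in>F. c w * w b) = (\<Sum>w\<in>F \<union> G. (if w \<in> F then c w else 0) * w b)" for b
      using F G by (intro sum.mono_neutral_cong_left) auto
    have 2: "(\<Sum>w\<in>G. d w * w b) = (\<Sum>w\<in>F \<union> G. (if w \<in> G then d w else 0) * w b)" for b
      using F G by (intro sum.mono_neutral_cong_left) auto
    show ?thesis unfolding fspan_def
      by (intro CollectI exI[of _ "F \<union> G"]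
          exI[of _ "\<lambda>w. (if w \<in> F then c w else 0) + (if w \<in> G then d w else 0)"])
        (use F G in \<open>simp add: 1 2 sum.distrib distrib_right\<close>)
  qed
  have s: "(\<lambda>b. k * v b) \<in> fspan S" if v: "v \<in> fspan S" for v :: "'b \<Rightarrow> 'k" and k
  proof -
    obtain F c where F: "finite F" "F \<subseteq> S" "v = (\<lambda>b. \<Sum>w\<in>F. c w * w b)"
      using v unfolding fspan_def by auto
    show ?thesis unfolding fspan_def
      by (intro CollectI exI[of _ F] exI[of _ "\<lambda>w. k * c w"])
        (use F in \<open>simp add: sum_distrib_left mult.assoc\<close>)
  qed
  show ?thesis unfolding subsp_def using z a s by blast
qed

lemma subsp_zero: "subsp V \<Longrightarrow> (\<lambda>_. 0) \<in> V"
  and subsp_add: "subsp V \<Longrightarrow> u \<in> V \<Longrightarrow> v \<in> V \<Longrightarrow> (\<lambda>b. u b + v b) \<in> V"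
  and subsp_scale: "subsp V \<Longrightarrow> v \<in> V \<Longrightarrow> (\<lambda>b. c * v b) \<in> V"
  by (simp_all add: subsp_def)

lemma subsp_diff: "subsp V \<Longrightarrow> u \<in> V \<Longrightarrow> v \<in> V \<Longrightarrow> (\<lambda>b. u b - v b) \<in> V"
  using subsp_add[of V u "\<lambda>b. (-1) * v b"] subsp_scale[of V v "-1"] by simp

lemma subsp_sum:
  assumes "subsp V" "\<And>a. a \<in> A \<Longrightarrow> f a \<in> V"
  shows "(\<lambda>b. \<Sum>a\<in>A. c a * f a b) \<in> V"
  using assms(2)
proof (induction A rule: infinite_finite_induct)
  case (insert a A)
  have "(\<lambda>b. c a * f a b + (\<Sum>a\<in>A. c a * f a b)) \<in> V"
    by (intro subsp_add[OF assms(1)] subsp_scale[OF assms(1)] insert) (use insert in auto)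
  then show ?case using insert by simp
qed (use subsp_zero[OF assms(1)] in simp_all)

lemma fspan_subset: "subsp V \<Longrightarrow> S \<subseteq> V \<Longrightarrow> fspan S \<subseteq> V"
  unfolding fspan_def by (auto intro!: subsp_sum)

lemma fspan_base: "u \<in> S \<Longrightarrow> u \<in> fspan S"
  using fspan_superset by blast

lemma fspan_UnE:
  assumes "v \<in> fspan (A \<union> S)" "subsp A"
  obtains a s where "a \<in> A" "s \<in> fspan S" "v = (\<lambda>b. a b + s b)"
proof -
  let ?V = "{v. \<exists>a\<in>A. \<exists>s\<in>fspan S. v = (\<lambda>b. a b + s b)}"
  have VI: "v \<in> ?V" if "a \<in> A" "s \<in> fspan S" "\<And>b. v b = a b + s b" for v a s
    using that by auto
  have "subsp ?V"
    unfolding subsp_def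
  proof (intro conjI ballI allI)
    show "(\<lambda>_. 0) \<in> ?V"
      by (rule VI[OF subsp_zero[OF assms(2)] subsp_zero[OF subsp_fspan]]) simp
  next
    fix u v assume "u \<in> ?V" "v \<in> ?V"
    then obtain a s a' s' where u: "u = (\<lambda>b. a b + s b)" "a \<in> A" "s \<in> fspan S"
      and v: "v = (\<lambda>b. a' b + s' b)" "a' \<in> A" "s' \<in> fspan S" by auto
    show "(\<lambda>b. u b + v b) \<in> ?V"
      by (rule VI[OF subsp_add[OF assms(2) u(2) v(2)] subsp_add[OF subsp_fspan u(3) v(3)]])
        (simp add: u v algebra_simps)
  next
    fix c v assume "v \<in> ?V"
    then obtain a' s' where v: "v = (\<lambda>b. a' b + s' b)" "a' \<in> A" "s' \<in> fspan S" by auto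
    show "(\<lambda>b. c * v b) \<in> ?V"
      by (rule VI[OF subsp_scale[OF assms(2) v(2), of c] subsp_scale[OF subsp_fspan v(3), of c]])
        (simp add: v algebra_simps)
  qed
  moreover have "A \<union> S \<subseteq> ?V"
  proof
    fix x assume "x \<in> A \<union> S"
    then show "x \<in> ?V"
    proof
      assume "x \<in> A"
      then show ?thesis by (rule VI[OF _ subsp_zero[OF subsp_fspan]]) simp
    next
      assume "x \<in> S"
      then show ?thesis by (rule VI[OF subsp_zero[OF assms(2)] fspan_base]) simp
    qed
  qed
  ultimately have "v \<in> ?V" using fspan_subset assms(1) by (meson subsetD)
  then show ?thesis using that by auto
qed

section \<open>Pairing of vectors with functionals\<close>

definition pair :: "('b \<Rightarrow> 'k::comm_ring_1) \<Rightarrow> ('b \<Rightarrow> 'k) \<Rightarrow> 'k" where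
  "pair z g = (\<Sum>a\<in>{a. z a \<noteq> 0}. z a * g a)"

lemma pair_eq: "finite S \<Longrightarrow> {a. z a \<noteq> 0} \<subseteq> S \<Longrightarrow> pair z g = (\<Sum>a\<in>S. z a * g a)"
  unfolding pair_def by (rule sum.mono_neutral_left) auto

lemma lin_eq_pair: "lin \<phi> v b = pair v (\<lambda>a. \<phi> a b)"
  by (simp add: lin_def pair_def)

lemma fin_supp_zero [simp]: "fin_supp (\<lambda>_. 0)"
  by (simp add: fin_supp_def)

lemma fin_supp_single [simp]: "fin_supp (single b c)"
  unfolding fin_supp_def single_def by (rule finite_subset[of _ "{b}"]) auto

lemma fin_supp_add: "fin_supp u \<Longrightarrow> fin_supp v \<Longrightarrow> fin_supp (\<lambda>b. u b + v b :: 'k::comm_ring_1)"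
  unfolding fin_supp_def by (rule finite_subset[of _ "{b. u b \<noteq> 0} \<union> {b. v b \<noteq> 0}"]) auto

lemma fin_supp_scale: "fin_supp v \<Longrightarrow> fin_supp (\<lambda>b. c * v b :: 'k::comm_ring_1)"
  unfolding fin_supp_def by (rule finite_subset[of _ "{b. v b \<noteq> 0}"]) auto

lemma pair_zero_left [simp]: "pair (\<lambda>_. 0) g = 0"
  by (simp add: pair_def)

lemma pair_single: "pair (single b c) g = c * g b"
  by (subst pair_eq[of "{b}"]) (auto simp: single_def)

lemma pair_add_left:
  assumes "fin_supp u" "fin_supp v"
  shows "pair (\<lambda>b. u b + v b) g = pair u g + pair v g"
proof -
  let ?S = "{b. u b \<noteq> 0} \<union> {b. v b \<noteq> 0}"
  have f: "finite ?S" using assms by (simp add: fin_supp_def)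
  have "pair (\<lambda>b. u b + v b) g = (\<Sum>a\<in>?S. (u a + v a) * g a)"
    by (rule pair_eq[OF f]) auto
  moreover have "pair u g = (\<Sum>a\<in>?S. u a * g a)" by (rule pair_eq[OF f]) auto
  moreover have "pair v g = (\<Sum>a\<in>?S. v a * g a)" by (rule pair_eq[OF f]) auto
  ultimately show ?thesis by (simp add: distrib_right sum.distrib)
qed

lemma pair_scale_left:
  assumes "fin_supp v"
  shows "pair (\<lambda>b. c * v b) g = c * pair v g"
proof -
  have "pair (\<lambda>b. c * v b) g = (\<Sum>a\<in>{b. v b \<noteq> 0}. (c * v a) * g a)"
    by (rule pair_eq) (use assms in \<open>auto simp: fin_supp_def\<close>)
  then show ?thesis by (simp add: pair_def sum_distrib_left mult.assoc)
qed

lemma subsp_fin_supp: "subsp {z. fin_supp z}"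
  unfolding subsp_def by (auto intro: fin_supp_add fin_supp_scale)

lemma pair_scale_right: "pair z (\<lambda>b. c * g b) = c * pair z g"
  by (simp add: pair_def sum_distrib_left mult.left_commute)

lemma pair_zero_right [simp]: "pair z (\<lambda>_. 0) = 0"
  by (simp add: pair_def)

lemma pair_delta: "fin_supp z \<Longrightarrow> pair z (single b 1) = z b"
  by (subst pair_eq[of "insert b {a. z a \<noteq> 0}"])
    (auto simp: single_def fin_supp_def if_distrib[of "(*) _"] sum.delta cong: if_cong)

text \<open>\<open>pair\<close> sums over the support of its first argument and is additive there
  only for finite supports, hence the condition \<open>fin_supp\<close> inside the
  annihilator.\<close>

lemma subsp_annihilator: "subsp {z. fin_supp z \<and> (\<forall>g\<in>G. pair z g = 0)}"
  unfolding subsp_def by (auto intro: fin_supp_add fin_supp_scale simp: pair_add_left pair_scale_left)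

lemma pair_sum_left:
  assumes "finite A" "\<And>a. a \<in> A \<Longrightarrow> fin_supp (f a)"
  shows "pair (\<lambda>b. \<Sum>a\<in>A. c a * f a b) g = (\<Sum>a\<in>A. c a * pair (f a) g)"
  using assms
proof (induction A)
  case (insert a A)
  have "fin_supp (\<lambda>b. \<Sum>a\<in>A. c a * f a b)"
    using subsp_sum[OF subsp_fin_supp, of A f c] insert by auto
  then show ?case using insert
    by (simp add: pair_add_left pair_scale_left fin_supp_scale)
qed simp

text \<open>A linear operator on finitely supported functions is handled through its transpose, which
  is given on a basis element by a formal linear combination, i.e. a list of terms.\<close>

definition ev :: "('k::comm_ring_1 \<times> 'b) list \<Rightarrow> ('b \<Rightarrow> 'k) \<Rightarrow> 'k" where
  "ev L g = (\<Sum>(c, b)\<leftarrow>L. c * g b)"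

text \<open>Coefficients are extracted by pairing with delta functions, so an identity between
  values of \<open>ev\<close> at all functionals specialises to an identity of vectors.\<close>

definition fl :: "('k::comm_ring_1 \<times> 'b) list \<Rightarrow> 'b \<Rightarrow> 'k" where
  "fl L = (\<lambda>b. ev L (single b 1))"

lemma ev_Nil [simp]: "ev [] g = 0"
  and ev_Cons [simp]: "ev ((c, b) # L) g = c * g b + ev L g"
  and ev_append [simp]: "ev (L @ L') g = ev L g + ev L' g"
  by (simp_all add: ev_def)

lemma ev_map: "ev (map (\<lambda>(c, b). (c, f b)) L) g = ev L (\<lambda>b. g (f b))"
  by (induction L) auto

lemma ev_map_uminus: "ev (map (\<lambda>(c, b). (- c, f b)) L) g = - ev L (\<lambda>b. g (f b))"
  by (induction L) auto

lemma ev_add: "ev L (\<lambda>b. f b + g b) = ev L f + ev L g"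
  by (induction L) (auto simp: algebra_simps)

lemma ev_diff: "ev L (\<lambda>b. f b - g b) = ev L f - ev L g"
  by (induction L) (auto simp: algebra_simps)

lemma ev_scale: "ev L (\<lambda>b. c * g b) = c * ev L g"
  by (induction L) (auto simp: algebra_simps)

lemma ev_uminus: "ev L (\<lambda>b. - g b) = - ev L g"
  by (induction L) auto

lemma ev_zero [simp]: "ev L (\<lambda>b. 0) = 0"
  by (induction L) auto

lemma ev_eq_0: "(\<And>c b. (c, b) \<in> set L \<Longrightarrow> g b = 0) \<Longrightarrow> ev L g = 0"
proof (induction L)
  case (Cons p L)
  then show ?case by (cases p) (metis ev_Cons list.set_intros add_0 mult_zero_right)
qed simp

lemma ev_swap: "ev L (\<lambda>b. ev M (f b)) = ev M (\<lambda>a. ev L (\<lambda>b. f b a))"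
  by (induction L) (auto simp: ev_add ev_scale)

lemma fl_Nil: "fl [] = (\<lambda>_. 0)"
  by (simp add: fl_def)

lemma fl_Cons: "fl ((c, b) # L) = (\<lambda>b'. c * single b 1 b' + fl L b')"
  by (auto simp: fl_def single_def)

lemma fin_supp_fl [simp]: "fin_supp (fl L)"
  by (induction L) (auto simp: fl_Nil fl_Cons intro!: fin_supp_add fin_supp_scale)

lemma pair_fl: "pair (fl L) g = ev L g"
  by (induction L) (auto simp: fl_Nil fl_Cons pair_add_left pair_scale_left fin_supp_scale pair_single)

lemma fl_supp: "fl L b \<noteq> 0 \<Longrightarrow> \<exists>c. (c, b) \<in> set L"
  by (induction L) (auto simp: fl_Nil fl_Cons single_def split: if_splits)

lemma fl_in_subsp:
  assumes "subsp V" "\<And>c b. (c, b) \<in> set L \<Longrightarrow> single b 1 \<in> V"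
  shows "fl L \<in> V"
  using assms(2)
proof (induction L)
  case (Cons p L)
  obtain c b where p: "p = (c, b)" by fastforce
  show ?case unfolding p fl_Cons
    by (intro subsp_add[OF assms(1)] subsp_scale[OF assms(1)])
      (use Cons p in \<open>meson list.set_intros\<close>)+
qed (simp add: fl_Nil subsp_zero[OF assms(1)])

lemma lin_fl_eq_sum:
  "(\<And>a. \<phi> a = fl (L a)) \<Longrightarrow> lin \<phi> v = (\<lambda>b. \<Sum>a\<in>{a. v a \<noteq> 0}. v a * fl (L a) b)"
  by (simp add: lin_def)

lemma fin_supp_lin: "(\<And>a. \<phi> a = fl (L a)) \<Longrightarrow> fin_supp (lin \<phi> v)"
  using subsp_sum[OF subsp_fin_supp, of "{a. v a \<noteq> 0}" "\<lambda>a. fl (L a)" v]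
  by (simp add: lin_fl_eq_sum)

lemma pair_lin:
  assumes "fin_supp v" "\<And>a. \<phi> a = fl (L a)"
  shows "pair (lin \<phi> v) g = pair v (\<lambda>a. ev (L a) g)"
  unfolding lin_fl_eq_sum[OF assms(2)] using assms(1)
  by (subst pair_sum_left) (auto simp: fin_supp_def[of v] pair_fl pair_def[of v])

lemma fin_supp_eqI:
  assumes "fin_supp u" "fin_supp v" "\<And>g. pair u g = pair v g"
  shows "u = v"
  using assms pair_delta by (metis ext)

lemma fin_supp_in_subsp:
  assumes "subsp V" "fin_supp z" "\<And>b. z b \<noteq> 0 \<Longrightarrow> single b 1 \<in> V"
  shows "z \<in> V"
proof -
  have "z = (\<lambda>b. \<Sum>a\<in>{a. z a \<noteq> 0}. z a * single a 1 b)"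
  proof
    fix b
    show "z b = (\<Sum>a\<in>{a. z a \<noteq> 0}. z a * single a 1 b)"
      using assms(2) by (cases "z b = 0")
        (auto simp: single_def fin_supp_def if_distrib[of "(*) _"] sum.delta cong: if_cong)
  qed
  moreover have "\<dots> \<in> V" by (rule subsp_sum[OF assms(1)]) (use assms(3) in auto)
  ultimately show ?thesis by simp
qed

section \<open>The operators on words and tuples\<close>

text \<open>\<open>gl\<close>, \<open>wl\<close>, \<open>tupl\<close> and \<open>dl\<close> restate
  the operators of the model by recursion on the word or tuple; inductions then replace sums over
  positions.\<close>

fun gl :: "sl2 \<Rightarrow> ('i,'j) gen \<Rightarrow> ('k::comm_ring_1 \<times> ('i,'j) gen) list" where
  "gl x (Tr i) = []"
| "gl SE (Ad j AE) = []"
| "gl SE (Ad j AH) = [(-2, Ad j AE)]"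
| "gl SE (Ad j AF) = [(1, Ad j AH)]"
| "gl SH (Ad j AE) = [(2, Ad j AE)]"
| "gl SH (Ad j AH) = []"
| "gl SH (Ad j AF) = [(-2, Ad j AF)]"
| "gl SF (Ad j AE) = [(-1, Ad j AH)]"
| "gl SF (Ad j AH) = [(2, Ad j AF)]"
| "gl SF (Ad j AF) = []"

primrec wl :: "sl2 \<Rightarrow> ('i,'j) gen list \<Rightarrow> ('k::comm_ring_1 \<times> ('i,'j) gen list) list" where
  "wl x [] = []"
| "wl x (y # w) = map (\<lambda>(c, b). (c, b # w)) (gl x y) @ map (\<lambda>(c, w'). (c, y # w')) (wl x w)"

primrec tupl :: "sl2 \<Rightarrow> ('i,'j) gen list list \<Rightarrow> ('k::comm_ring_1 \<times> ('i,'j) gen list list) list" where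
  "tupl x [] = []"
| "tupl x (u # t) = map (\<lambda>(c, w). (c, w # t)) (wl x u) @ map (\<lambda>(c, s). (c, u # s)) (tupl x t)"

text \<open>The sign (-1)^i of the merge at position i becomes one change of sign for each entry
  passed.\<close>

fun dl :: "'g list list \<Rightarrow> ('k::comm_ring_1 \<times> 'g list list) list" where
  "dl [] = []"
| "dl [u] = []"
| "dl (u # v # t) = (1, (u @ v) # t) # map (\<lambda>(c, s). (- c, u # s)) (dl (v # t))"

lemma gen_act_fl: "gen_act x y = fl (gl x y)"
  by (cases "(x, y)" rule: gl.cases) (auto simp: fl_def single_def fun_eq_iff)

lemma word_act_Nil: "word_act x [] w = 0"
  by (simp add: word_act_def)

lemma word_act_Cons_Nil: "word_act x (y # w) [] = 0"
  unfolding word_act_def by (rule sum.neutral) (metis list_update_nonempty list.discI)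

lemma word_act_Cons_Cons: "word_act x (y # w) (b # w') =
   (if w' = w then gen_act x y b else 0) + (if b = y then word_act x w w' else 0)"
proof -
  have "(\<Sum>i<length w. if b # w' = (y # w)[Suc i := (b # w') ! Suc i]
      then gen_act x ((y # w) ! Suc i) ((b # w') ! Suc i) else 0)
    = (\<Sum>i<length w. if b = y then if w' = w[i := w' ! i] then gen_act x (w ! i) (w' ! i) else 0 else 0)"
    by (rule sum.cong[OF refl]) (simp only: nth_Cons_Suc list_update_code list.inject, simp)
  note eq = this
  show ?thesis
    unfolding word_act_def length_Cons sum.lessThan_Suc_shift eq by simp
qed

lemma ev_single_head:
  "ev L (\<lambda>b. single (y # w) 1 (b # v)) = (if w = v then ev L (single y 1) else 0)"
  by (induction L) (auto simp: single_def)

lemma ev_single_tail: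
  "ev L (\<lambda>s. single (y # w) 1 (v # s)) = (if y = v then ev L (single w 1) else 0)"
  by (induction L) (auto simp: single_def)

lemma ev_single_Nil: "ev L (\<lambda>s. single [] 1 (f s # g s)) = 0"
  by (induction L) (auto simp: single_def)

lemma word_act_fl: "word_act x w = fl (wl x w)"
proof
  fix w'
  show "word_act x w w' = fl (wl x w) w'"
  proof (induction w arbitrary: w')
    case Nil
    then show ?case by (simp add: word_act_Nil fl_Nil)
  next
    case (Cons y w)
    then show ?case
      by (cases w') (auto simp: word_act_Cons_Nil word_act_Cons_Cons gen_act_fl fl_def ev_map
        ev_single_head ev_single_tail ev_single_Nil)
  qed
qed

lemma tup_act_Cons_Nil: "tup_act x (y # w) [] = 0"
  unfolding tup_act_def by (rule sum.neutral) (metis list_update_nonempty list.discI)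

lemma tup_act_Cons_Cons: "tup_act x (y # w) (b # w') =
   (if w' = w then word_act x y b else 0) + (if b = y then tup_act x w w' else 0)"
proof -
  have "(\<Sum>i<length w. if b # w' = (y # w)[Suc i := (b # w') ! Suc i]
      then word_act x ((y # w) ! Suc i) ((b # w') ! Suc i) else 0)
    = (\<Sum>i<length w. if b = y then if w' = w[i := w' ! i] then word_act x (w ! i) (w' ! i) else 0 else 0)"
    by (rule sum.cong[OF refl]) (simp only: nth_Cons_Suc list_update_code list.inject, simp)
  note eq = this
  show ?thesis
    unfolding tup_act_def length_Cons sum.lessThan_Suc_shift eq by simp
qed

lemma tup_act_fl: "tup_act x t = fl (tupl x t)"
proof
  fix t'
  show "tup_act x t t' = fl (tupl x t) t'"
  proof (induction t arbitrary: t')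
    case Nil
    then show ?case by (simp add: tup_act_def fl_Nil)
  next
    case (Cons y w)
    then show ?case
      by (cases t') (auto simp: tup_act_Cons_Nil tup_act_Cons_Cons word_act_fl fl_def ev_map
        ev_single_head ev_single_tail ev_single_Nil)
  qed
qed

lemma bar_d_fl:
  fixes t :: "'g list list"
  shows "(bar_d t :: _ \<Rightarrow> 'k::comm_ring_1) = fl (dl t)"
proof
  fix t' :: "'g list list"
  show "bar_d t t' = (fl (dl t) t' :: 'k)"
  proof (induction t arbitrary: t' rule: dl.induct)
    case (3 u v t)
    have *: "{i. Suc i < length (u # v # t)} = insert 0 (Suc ` {i. Suc i < length (v # t)})"
      using lessThan_Suc_eq_insert_0[of "length t"] by (simp add: lessThan_def)
    have fin: "finite {i. Suc i < length (v # t)}"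
      by (rule finite_subset[of _ "{..length (v # t)}"]) auto
    have 1: "bar_d (u # v # t) t' = (if t' = (u @ v) # t then 1 else 0)
        + (\<Sum>i | Suc i < length (v # t). if t' = u # merge i (v # t) then (- 1) ^ Suc i else (0::'k))"
      unfolding bar_d_def * using fin
      by (subst sum.insert) (simp_all add: sum.reindex merge_def del: length_Cons cong: if_cong)
    have 2: "(\<Sum>i | Suc i < length (v # t). if t' = u # merge i (v # t) then (- 1) ^ Suc i else (0::'k))
        = - ev (dl (v # t)) (\<lambda>s. single t' 1 (u # s))"
    proof (cases "\<exists>s. t' = u # s")
      case True
      then obtain s where s: "t' = u # s" by blast
      have "(\<Sum>i | Suc i < length (v # t). if t' = u # merge i (v # t) then (- 1) ^ Suc i else (0::'k))
          = - bar_d (v # t) s"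
        unfolding bar_d_def sum_negf[symmetric] by (rule sum.cong) (auto simp: s)
      also have "\<dots> = - ev (dl (v # t)) (\<lambda>s. single t' 1 (u # s))"
        unfolding 3 s ev_single_tail by (simp add: fl_def)
      finally show ?thesis .
    next
      case False
      have "ev (dl (v # t)) (\<lambda>s. single t' 1 (u # s)) = (0::'k)"
        by (rule ev_eq_0) (use False in \<open>auto simp: single_def\<close>)
      moreover have "(\<Sum>i | Suc i < length (v # t).
          if t' = u # merge i (v # t) then (- 1) ^ Suc i else (0::'k)) = 0"
        by (rule sum.neutral) (use False in auto)
      ultimately show ?thesis by simp
    qed
    show ?case unfolding 1 2 by (auto simp: fl_def ev_map_uminus) (auto simp: single_def)
  qed (auto simp: bar_d_def fl_def)
qed

lemma ev_wl_Cons: "ev (wl x (y # w)) g = ev (gl x y) (\<lambda>b. g (b # w)) + ev (wl x w) (\<lambda>w. g (y # w))"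
  by (simp add: ev_map)

lemma ev_wl_append:
  "ev (wl x (u @ v)) g = ev (wl x u) (\<lambda>w. g (w @ v)) + ev (wl x v) (\<lambda>w. g (u @ w))"
  by (induction u arbitrary: g) (auto simp: ev_map)

lemma ev_tupl_Cons: "ev (tupl x (u # t)) g = ev (wl x u) (\<lambda>w. g (w # t)) + ev (tupl x t) (\<lambda>s. g (u # s))"
  by (simp add: ev_map)

lemma ev_dl_Cons: "ev (dl (u # v # t)) g = g ((u @ v) # t) - ev (dl (v # t)) (\<lambda>s. g (u # s))"
  by (simp add: ev_map_uminus)

text \<open>Concatenation is equivariant because sl2 acts by derivations. In \<open>L4_copy\<close>
  this transports the action from pairs of blocks to words.\<close>

lemma ev_wl_concat: "ev (tupl x t) (\<lambda>s. g (concat s)) = ev (wl x (concat t)) g"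
  by (induction t arbitrary: g) (auto simp: ev_wl_append ev_map)

text \<open>Acting on a merged entry obeys the derivation rule \<open>ev_wl_append\<close>, and the
  other merges are covered by induction; so the differential commutes with sl2.\<close>

lemma ev_dl_tupl: "ev (dl t) (\<lambda>s. ev (tupl x s) g) = ev (tupl x t) (\<lambda>s. ev (dl s) g)"
proof (induction t arbitrary: g rule: dl.induct)
  case (3 u v t)
  have "ev (dl (u # v # t)) (\<lambda>s. ev (tupl x s) g)
     = ev (wl x (u @ v)) (\<lambda>w. g (w # t)) + ev (tupl x t) (\<lambda>s. g ((u @ v) # s))
      - ev (dl (v # t)) (\<lambda>s. ev (wl x u) (\<lambda>w. g (w # s)))
      - ev (dl (v # t)) (\<lambda>s. ev (tupl x s) (\<lambda>s. g (u # s)))"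
    unfolding ev_dl_Cons ev_tupl_Cons by (simp add: ev_add)
  also have "\<dots> = ev (wl x u) (\<lambda>w. g ((w @ v) # t)) + ev (wl x v) (\<lambda>w. g ((u @ w) # t))
      + ev (tupl x t) (\<lambda>s. g ((u @ v) # s))
      - ev (wl x u) (\<lambda>w. ev (dl (v # t)) (\<lambda>s. g (w # s)))
      - (ev (wl x v) (\<lambda>w. ev (dl (w # t)) (\<lambda>s. g (u # s)))
       + ev (tupl x t) (\<lambda>s. ev (dl (v # s)) (\<lambda>s. g (u # s))))"
    unfolding 3 ev_tupl_Cons ev_wl_append by (subst ev_swap) (rule refl)
  also have "\<dots> = ev (tupl x (u # v # t)) (\<lambda>s. ev (dl s) g)"
    unfolding ev_tupl_Cons ev_dl_Cons ev_diff by simp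
  finally show ?case .
qed (simp_all add: ev_map)

text \<open>All terms in which \<open>u\<close> is merged cancel in pairs, by associativity or
  because two distant merges can be made in either order. What remains is the double differential of
  the tail.\<close>

lemma ev_dl_dl: "ev (dl t) (\<lambda>s. ev (dl s) g) = 0"
proof (induction t arbitrary: g rule: dl.induct)
  case (3 u v t)
  show ?case
  proof (cases t)
    case (Cons w t')
    have "ev (dl (u # v # t)) (\<lambda>s. ev (dl s) g)
      = ev (dl (v # w # t')) (\<lambda>s. ev (dl s) (\<lambda>s. g (u # s)))"
      unfolding ev_dl_Cons Cons ev_diff by simp
    then show ?thesis by (simp only: 3[unfolded Cons])
  qed simp
qed simp_all

section \<open>Functionals satisfying the relations\<close>

text \<open>The quotient is governed by the relations ee = 0, eh + he = 0, ef + fe = hh, hf + fh = 0,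
  ff = 0 between adjacent adjoint letters, possibly with trivial letters in between: they span
  the copies of L(4) in the tensor square of L(2).\<close>

definition relations :: "(adjb \<Rightarrow> adjb \<Rightarrow> 'k::comm_ring_1) \<Rightarrow> bool" where
  "relations E \<longleftrightarrow> E AE AE = 0 \<and> E AE AH + E AH AE = 0 \<and> E AE AF + E AF AE = E AH AH
     \<and> E AH AF + E AF AH = 0 \<and> E AF AF = 0"

definition Rel :: "(('i,'j) gen list \<Rightarrow> 'k::comm_ring_1) \<Rightarrow> bool" where
  "Rel \<phi> \<longleftrightarrow> (\<forall>p a q j j'. set a \<subseteq> range Tr \<longrightarrow> relations (\<lambda>x y. \<phi> (p @ Ad j x # a @ Ad j' y # q)))"

text \<open>By \<open>Jsp_eq\<close> the common kernel of these functionals in \<open>Bsp\<close> is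
  \<open>Jsp\<close>, so they stand for the functionals on the bar complex of the quotient.\<close>

definition RelT :: "(('i,'j) gen list list \<Rightarrow> 'k::comm_ring_1) \<Rightarrow> bool" where
  "RelT g \<longleftrightarrow> (\<forall>t t'. Rel (\<lambda>w. g (t @ w # t')))"

lemma RelD: "Rel \<phi> \<Longrightarrow> set a \<subseteq> range Tr \<Longrightarrow> relations (\<lambda>x y. \<phi> (p @ Ad j x # a @ Ad j' y # q))"
  by (simp add: Rel_def)

lemma RelTD: "RelT g \<Longrightarrow> Rel (\<lambda>w. g (t @ w # t'))"
  by (simp add: RelT_def)

lemma RelT_Cons: "RelT g \<Longrightarrow> RelT (\<lambda>s. g (u # s))"
  unfolding RelT_def[of "\<lambda>s. g (u # s)"] using RelTD[of g "u # _"] by simp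

lemma relations_add: "relations E \<Longrightarrow> relations F \<Longrightarrow> relations (\<lambda>x y. E x y + F x y)"
proof -
  assume E: "relations E" and F: "relations F"
  have "E AE AH = - E AH AE" "E AE AF = E AH AH - E AF AE" "E AH AF = - E AF AH"
    "F AE AH = - F AH AE" "F AE AF = F AH AH - F AF AE" "F AH AF = - F AF AH"
    using E F unfolding relations_def by (simp_all add: eq_neg_iff_add_eq_0 eq_diff_eq)
  then show ?thesis using E F unfolding relations_def by simp
qed

lemma relations_scale: "relations E \<Longrightarrow> relations (\<lambda>x y. c * E x y)"
  unfolding relations_def by (simp add: distrib_left[symmetric])

lemma relations_diff: "relations E \<Longrightarrow> relations F \<Longrightarrow> relations (\<lambda>x y. E x y - F x y)"
  using relations_add[of E "\<lambda>x y. (-1) * F x y"] relations_scale[of F "-1"] by simp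

lemma relations_ev: "(\<And>b. relations (E b)) \<Longrightarrow> relations (\<lambda>x y. ev L (\<lambda>b. E b x y))"
proof (induction L)
  case (Cons p L)
  then show ?case by (cases p) (simp add: relations_add relations_scale)
qed (simp add: relations_def)

lemma Rel_zero: "Rel (\<lambda>_. 0)"
  by (simp add: Rel_def relations_def)

lemma Rel_add: "Rel \<phi> \<Longrightarrow> Rel \<psi> \<Longrightarrow> Rel (\<lambda>w. \<phi> w + \<psi> w)"
  unfolding Rel_def by (intro allI impI relations_add) auto

lemma Rel_scale: "Rel \<phi> \<Longrightarrow> Rel (\<lambda>w. c * \<phi> w)"
  unfolding Rel_def by (intro allI impI relations_scale) auto

lemma Rel_scale_right: "Rel \<phi> \<Longrightarrow> Rel (\<lambda>w. \<phi> w * c)"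
  using Rel_scale[of \<phi> c] by (simp add: mult.commute)

lemma Rel_diff: "Rel \<phi> \<Longrightarrow> Rel \<psi> \<Longrightarrow> Rel (\<lambda>w. \<phi> w - \<psi> w)"
  unfolding Rel_def by (intro allI impI relations_diff) auto

lemma Rel_ev: "(\<And>b. Rel (\<phi> b)) \<Longrightarrow> Rel (\<lambda>w. ev L (\<lambda>b. \<phi> b w))"
  unfolding Rel_def by (intro allI impI relations_ev) auto

lemma Rel_context: "Rel \<phi> \<Longrightarrow> Rel (\<lambda>w. \<phi> (p @ w @ q))"
  unfolding Rel_def[of "\<lambda>w. \<phi> (p @ w @ q)"]
  using RelD[of \<phi> _ "p @ _" _ _ "_ @ q"] by simp

lemma wl_trivial: "set a \<subseteq> range Tr \<Longrightarrow> wl x a = []"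
  by (induction a) auto

text \<open>The five relations span a submodule L(4) of the tensor square of L(2), so the
  functionals vanishing on it form a stable space.\<close>

lemma relations_act:
  fixes g :: "('i,'j) gen \<Rightarrow> ('i,'j) gen \<Rightarrow> 'k::comm_ring_1"
  assumes "relations (\<lambda>x y. g (Ad j x) (Ad j' y))"
  shows "relations (\<lambda>x y. ev (gl z (Ad j x)) (\<lambda>b. g b (Ad j' y)) + ev (gl z (Ad j' y)) (g (Ad j x)))"
proof -
  have "g (Ad j AE) (Ad j' AH) = - g (Ad j AH) (Ad j' AE)"
    "g (Ad j AH) (Ad j' AH) = g (Ad j AE) (Ad j' AF) + g (Ad j AF) (Ad j' AE)"
    "g (Ad j AH) (Ad j' AF) = - g (Ad j AF) (Ad j' AH)"
    "g (Ad j AE) (Ad j' AE) = 0" "g (Ad j AF) (Ad j' AF) = 0"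
    using assms unfolding relations_def by (simp_all add: eq_neg_iff_add_eq_0 eq_diff_eq)
  then show ?thesis unfolding relations_def
    by (cases z) (simp_all add: algebra_simps)
qed

text \<open>The action on \<open>p\<close> or \<open>q\<close> gives further instances of the
  relation, the trivial letters in \<open>a\<close> are killed, and \<open>relations_act\<close>
  treats the two adjoint letters.\<close>

lemma Rel_wl:
  assumes "Rel \<phi>"
  shows "Rel (\<lambda>w. ev (wl z w) \<phi>)"
  unfolding Rel_def
proof (intro allI impI)
  fix p a q and j j' :: 'b
  assume a: "set a \<subseteq> range (Tr :: 'a \<Rightarrow> ('a, 'b) gen)"
  have *: "ev (wl z (p @ Ad j x # a @ Ad j' y # q)) \<phi> =
     ev (wl z p) (\<lambda>p. \<phi> (p @ Ad j x # a @ Ad j' y # q))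
     + (ev (gl z (Ad j x)) (\<lambda>b. \<phi> (p @ b # a @ Ad j' y # q))
      + ev (gl z (Ad j' y)) (\<lambda>b. \<phi> (p @ Ad j x # a @ b # q)))
     + ev (wl z q) (\<lambda>q. \<phi> (p @ Ad j x # a @ Ad j' y # q))" for x y
    unfolding ev_wl_append ev_wl_Cons wl_trivial[OF a] by (simp add: algebra_simps)
  show "relations (\<lambda>x y. ev (wl z (p @ Ad j x # a @ Ad j' y # q)) \<phi>)"
    unfolding * by (intro relations_add relations_ev RelD[OF assms a]
        relations_act[where g = "\<lambda>b b'. \<phi> (p @ b # a @ b' # q)"])
qed

lemma RelT_tupl:
  assumes "RelT g"
  shows "RelT (\<lambda>t. ev (tupl x t) g)"
proof -
  have "Rel (\<lambda>w. ev (tupl x (t @ w # t')) g)" for t t'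
    using assms
  proof (induction t arbitrary: g)
    case Nil
    show ?case unfolding append_Nil ev_tupl_Cons
      by (intro Rel_add Rel_wl Rel_ev) (use RelTD[OF Nil, of "[]"] in simp_all)
  next
    case (Cons u t)
    show ?case unfolding append_Cons ev_tupl_Cons
      by (intro Rel_add Rel_ev Cons.IH RelT_Cons[OF Cons.prems])
        (use RelTD[OF Cons.prems, of "_ # t"] in simp)
  qed
  then show ?thesis by (simp add: RelT_def)
qed

text \<open>A relation in an entry survives the merge with a neighbour, because \<open>Rel\<close>
  allows any context \<open>p\<close>, \<open>q\<close>.\<close>

lemma RelT_dl:
  assumes "RelT g"
  shows "RelT (\<lambda>t. ev (dl t) g)"
proof -
  have 0: "Rel (\<lambda>w. ev (dl (w # t')) g)" if g: "RelT g" for t' and g :: "('a, 'b) gen list list \<Rightarrow> 'c"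
  proof (cases t')
    case (Cons v s)
    show ?thesis unfolding Cons ev_dl_Cons
      by (intro Rel_diff Rel_ev)
        (use RelTD[OF g, of "[]"] Rel_context[of "\<lambda>w. g (w # s)" "[]" v] in simp_all)
  qed (simp add: Rel_zero)
  have "Rel (\<lambda>w. ev (dl (t @ w # t')) g)" for t t'
    using assms
  proof (induction t arbitrary: g)
    case Nil
    then show ?case using 0 by simp
  next
    case (Cons u t)
    show ?case
    proof (cases t)
      case Nil
      have "Rel (\<lambda>w. g ((u @ w) # t'))"
        using Rel_context[OF RelTD[OF Cons.prems, of "[]" t'], of u "[]"] by simp
      then show ?thesis unfolding Nil append_Cons append_Nil ev_dl_Cons
        by (intro Rel_diff 0 RelT_Cons[OF Cons.prems])
    next
      case (Cons v r)
      show ?thesis unfolding Cons append_Cons ev_dl_Cons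
        by (intro Rel_diff, use RelTD[OF Cons.prems, of "(u @ v) # r" t'] in simp,
            use Cons.IH[OF RelT_Cons[OF Cons.prems], of u] Cons in simp)
    qed
  qed
  then show ?thesis by (simp add: RelT_def)
qed

section \<open>Copies of irreducible modules\<close>

text \<open>A pair (a, j) is a block whose adjoint letter is left open: the trivial letters
  \<open>a\<close> and the index \<open>j\<close> of the adjoint summand. A list of such pairs is
  called a skeleton.\<close>

primrec fill :: "('i,'j) gen list \<times> 'j \<Rightarrow> adjb \<Rightarrow> ('i,'j) gen list" where
  "fill (a, j) x = a @ [Ad j x]"

definition trivial_sk :: "(('i,'j) gen list \<times> 'j) list \<Rightarrow> bool" where
  "trivial_sk sk \<longleftrightarrow> (\<forall>(a, j)\<in>set sk. set a \<subseteq> range Tr)"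

text \<open>Here exp(sF) maps e to e - sh - ssf, and the following is the coefficient of the d-th power
  of s in the tensor product of copies of this vector, one for each entry of the skeleton. It spans
  the weight space of weight 2n - 2d in the copy of L(2n) generated by the tensor power of e.
  Integral d saves side conditions: the coefficient is 0 unless d lies between 0 and 2n.\<close>

primrec tauL :: "(('i,'j) gen list \<times> 'j) list \<Rightarrow> int \<Rightarrow> ('k::comm_ring_1 \<times> ('i,'j) gen list list) list" where
  "tauL [] d = (if d = 0 then [(1, [])] else [])"
| "tauL (s # sk) d = map (\<lambda>(c, t). (c, fill s AE # t)) (tauL sk d)
     @ map (\<lambda>(c, t). (- c, fill s AH # t)) (tauL sk (d - 1))
     @ map (\<lambda>(c, t). (- c, fill s AF # t)) (tauL sk (d - 2))"

lemma ev_tauL_Cons: "ev (tauL (s # sk) d) g = ev (tauL sk d) (\<lambda>t. g (fill s AE # t))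
    - ev (tauL sk (d - 1)) (\<lambda>t. g (fill s AH # t)) - ev (tauL sk (d - 2)) (\<lambda>t. g (fill s AF # t))"
  by (simp add: ev_map ev_map_uminus)

lemma ev_wl_fill:
  "set a \<subseteq> range Tr \<Longrightarrow> ev (wl x (fill (a, j) y)) g = ev (gl x (Ad j y)) (\<lambda>b. g (a @ [b]))"
  by (simp add: ev_wl_append wl_trivial ev_map)

lemma trivial_sk_Cons: "trivial_sk ((a, j) # sk) \<longleftrightarrow> set a \<subseteq> range Tr \<and> trivial_sk sk"
  by (simp add: trivial_sk_def)

lemma trivial_sk_Nil: "trivial_sk []"
  by (simp add: trivial_sk_def)

text \<open>Differentiating exp(sF) with respect to s multiplies it by F; comparing the coefficients
  of s^d gives the factor d + 1.\<close>

lemma tauL_F: "trivial_sk sk \<Longrightarrow>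
   ev (tauL sk d) (\<lambda>t. ev (tupl SF t) g) = of_int (d + 1) * ev (tauL sk (d + 1)) g"
proof (induction sk arbitrary: d g)
  case (Cons s sk)
  obtain a j where s: "s = (a, j)" by fastforce
  note tr = Cons.prems[unfolded s trivial_sk_Cons]
  show ?case unfolding s ev_tauL_Cons ev_tupl_Cons ev_add ev_wl_fill[OF conjunct1[OF tr]]
      Cons.IH[OF conjunct2[OF tr]]
    by (simp add: ev_scale ev_uminus algebra_simps)
next
  case Nil
  \<comment> \<open>At d = -1 the term \<open>tauL [] 0\<close> on the right is not empty; the
    factor d + 1 = 0 kills it.\<close>
  then show ?case by (cases "d = - 1") auto
qed

lemma tauL_H: "trivial_sk sk \<Longrightarrow>
   ev (tauL sk d) (\<lambda>t. ev (tupl SH t) g) = of_int (2 * int (length sk) - 2 * d) * ev (tauL sk d) g"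
proof (induction sk arbitrary: d g)
  case (Cons s sk)
  obtain a j where s: "s = (a, j)" by fastforce
  note tr = Cons.prems[unfolded s trivial_sk_Cons]
  show ?case unfolding s ev_tauL_Cons ev_tupl_Cons ev_add ev_wl_fill[OF conjunct1[OF tr]]
      Cons.IH[OF conjunct2[OF tr]]
    by (simp add: ev_scale ev_uminus algebra_simps)
qed simp

text \<open>In L(2n) the vector e f^d v_0 is d (2n + 1 - d) f^(d-1) v_0. Passing to the divided
  powers f^d v_0 / d! removes the factor d.\<close>

lemma tauL_E: "trivial_sk sk \<Longrightarrow>
   ev (tauL sk d) (\<lambda>t. ev (tupl SE t) g) = of_int (2 * int (length sk) - d + 1) * ev (tauL sk (d - 1)) g"
proof (induction sk arbitrary: d g)
  case (Cons s sk)
  obtain a j where s: "s = (a, j)" by fastforce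
  note tr = Cons.prems[unfolded s trivial_sk_Cons]
  show ?case unfolding s ev_tauL_Cons ev_tupl_Cons ev_add ev_wl_fill[OF conjunct1[OF tr]]
      Cons.IH[OF conjunct2[OF tr]]
    by (simp add: ev_scale ev_uminus algebra_simps)
qed simp

lemma tauL_out_of_range: "d < 0 \<or> 2 * int (length sk) < d \<Longrightarrow> tauL sk d = []"
  by (induction sk arbitrary: d) auto

section \<open>Words in a context, and the copies of L(4)\<close>

lemma shift_append: "shift p q g (p @ m @ q) = g m"
  by (simp add: shift_def)

lemma shift_outside: "(\<And>m. b \<noteq> p @ m @ q) \<Longrightarrow> shift p q g b = 0"
proof (rule ccontr)
  assume b: "\<And>m. b \<noteq> p @ m @ q" and "shift p q g b \<noteq> 0"
  then have h: "length p + length q \<le> length b" "take (length p) b = p"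
    "drop (length b - length q) b = q"
    by (auto simp: shift_def split: if_splits)
  have "b = take (length b - length q) b @ q"
    using h(3) by (metis append_take_drop_id)
  moreover have "take (length b - length q) b
      = p @ drop (length p) (take (length b - length q) b)"
    using h(1,2) by (metis append_take_drop_id take_take min.absorb1 le_diff_conv2 add_leD2)
  ultimately show False using b by (metis append.assoc)
qed

lemma shift_fl: "shift p q (fl L) = fl (map (\<lambda>(c, w). (c, p @ w @ q)) L)"
proof
  fix b
  show "shift p q (fl L) b = fl (map (\<lambda>(c, w). (c, p @ w @ q)) L) b"
  proof (cases "\<exists>m. b = p @ m @ q")
    case True
    then obtain m where b: "b = p @ m @ q" by blast
    show ?thesis unfolding b shift_append by (simp add: fl_def ev_map single_def)
  next
    case False
    have "ev L (\<lambda>w. single b 1 (p @ w @ q)) = 0"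
      by (rule ev_eq_0) (use False in \<open>auto simp: single_def\<close>)
    then show ?thesis using False by (simp add: shift_outside fl_def ev_map)
  qed
qed

lemma fin_supp_shift_pair:
  assumes "fin_supp g"
  shows "fin_supp (shift p q g)" "pair (shift p q g) \<phi> = pair g (\<lambda>w. \<phi> (p @ w @ q))"
proof -
  have inj: "inj_on (\<lambda>m. p @ m @ q) {m. g m \<noteq> 0}" by (simp add: inj_on_def)
  have *: "{b. shift p q g b \<noteq> 0} = (\<lambda>m. p @ m @ q) ` {m. g m \<noteq> 0}"
  proof (intro equalityI subsetI)
    fix b assume "b \<in> {b. shift p q g b \<noteq> 0}"
    then obtain m where "b = p @ m @ q" "shift p q g b \<noteq> 0" using shift_outside by blast
    then show "b \<in> (\<lambda>m. p @ m @ q) ` {m. g m \<noteq> 0}" by (auto simp: shift_append)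
  qed (auto simp: shift_append)
  show "fin_supp (shift p q g)" using assms unfolding fin_supp_def * by simp
  show "pair (shift p q g) \<phi> = pair g (\<lambda>w. \<phi> (p @ w @ q))"
    unfolding pair_def * by (simp add: sum.reindex[OF inj] shift_append)
qed

lemma lin_scale: "fin_supp v \<Longrightarrow> lin \<phi> (\<lambda>b. c * v b) = (\<lambda>b. c * lin \<phi> v b)"
  by (simp add: lin_eq_pair fun_eq_iff pair_scale_left)

lemma lin_fl: "lin \<phi> (fl L) b = ev L (\<lambda>a. \<phi> a b)"
  by (simp add: lin_eq_pair pair_fl)

lemma mem_gens_iff [simp]: "Tr i \<in> gens I J \<longleftrightarrow> i \<in> I" "Ad j x \<in> gens I J \<longleftrightarrow> j \<in> J"
  by (auto simp: gens_def)

text \<open>For the skeleton \<open>[([], j), (a, j')]\<close>, concatenated to words x a y,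
  \<open>tauL\<close> is the string of L(4) in the tensor square of L(2). The factor
  \<open>fact i\<close> passes from divided powers to the basis f^i v_0 of
  \<open>is_Lcopy\<close>.\<close>

lemma L4_copy:
  fixes a :: "('i,'j) gen list"
  assumes "set a \<subseteq> range Tr" "set a \<subseteq> gens I J" "j \<in> J" "j' \<in> J"
  defines "w \<equiv> \<lambda>i::nat. \<lambda>b. of_nat (fact i) *
     fl (map (\<lambda>(c, t). (c, concat t)) (tauL [([], j), (a, j')] (int i))) b"
  shows "is_Lcopy (\<lambda>x. lin (word_act x)) (TU I J) {\<lambda>_. 0 :: 'k::field_char_0} 4 w"
proof -
  let ?sk = "[([], j), (a, j')]"
  define v :: "int \<Rightarrow> ('i,'j) gen list \<Rightarrow> 'k"
    where "v d = fl (map (\<lambda>(c, t). (c, concat t)) (tauL ?sk d))" for d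
  have w: "w i = (\<lambda>b. of_nat (fact i) * v (int i) b)" for i
    by (simp add: w_def v_def)
  have tr: "trivial_sk ?sk" using assms(1) by (simp add: trivial_sk_def)
  have act: "lin (word_act x) (v d) b
      = ev (tauL ?sk d) (\<lambda>t. ev (tupl x t) (\<lambda>s. single b 1 (concat s)))" for x d b
    unfolding v_def lin_fl ev_map ev_wl_concat word_act_fl by (simp add: fl_def)
  have v: "v d b = ev (tauL ?sk d) (\<lambda>s. single b 1 (concat s))" for d b
    by (simp add: v_def fl_def ev_map)
  have F: "lin (word_act SF) (v d) = (\<lambda>b. of_int (d + 1) * v (d + 1) b)" for d
    unfolding fun_eq_iff act tauL_F[OF tr] by (simp add: v)
  have H: "lin (word_act SH) (v d) = (\<lambda>b. of_int (4 - 2 * d) * v d b)" for d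
    unfolding fun_eq_iff act tauL_H[OF tr] by (simp add: v)
  have E: "lin (word_act SE) (v d) = (\<lambda>b. of_int (5 - d) * v (d - 1) b)" for d
    unfolding fun_eq_iff act tauL_E[OF tr] by (simp add: v)
  have fin: "fin_supp (v d)" for d by (simp add: v_def)
  have TU: "w i \<in> TU I J" for i
  proof -
    have "set b \<subseteq> gens I J" if nz: "v d b \<noteq> 0" for d b
    proof -
      obtain c where "(c, b) \<in> set (map (\<lambda>(c, t). (c, concat t)) (tauL ?sk d :: ('k \<times> _) list))"
        using fl_supp[OF nz[unfolded v_def]] by blast
      then show ?thesis using assms by (auto split: if_splits)
    qed
    then show ?thesis unfolding w TU_def by (auto intro: fin_supp_scale fin)
  qed
  have ind: "\<forall>i\<le>4. c i = 0" if "(\<lambda>b. \<Sum>i\<le>4. c i * w i b) \<in> {\<lambda>_. 0}" for c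
  proof -
    have z: "(\<Sum>i\<le>4. c i * w i (Ad j x # a @ [Ad j' y])) = 0" for x y
      using that by (simp add: fun_eq_iff)
    have le4: "{..4::nat} = {0, 1, 2, 3, 4}" by auto
    \<comment> \<open>The words with letters ee, eh, hh, hf, ff have degrees 0 to 4 in s, so each
      occurs in exactly one of the five vectors and isolates its coefficient.\<close>
    have "c 0 = 0" "c 1 = 0" "c 2 = 0" "c 3 = 0" "c 4 = 0"
      using z[of AE AE] z[of AE AH] z[of AH AH] z[of AH AF] z[of AF AF]
      by (simp_all add: le4 w v single_def)
    moreover have "i = 0 \<or> i = 1 \<or> i = 2 \<or> i = 3 \<or> i = 4" if "i \<le> 4" for i :: nat
      using that by auto
    ultimately show ?thesis by blast
  qed
  \<comment> \<open>The string stops at both ends because 5 and -1 lie outside the range 0 to 4 of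
    the degree.\<close>
  have v5: "v 5 = (\<lambda>_. 0)" and vm: "v (-1) = (\<lambda>_. 0)"
    by (simp_all add: v_def fl_Nil del: tauL.simps add: tauL_out_of_range)
  show ?thesis unfolding is_Lcopy_def
  proof (intro conjI allI impI)
    fix i :: nat assume "1 \<le> i \<and> i \<le> 4"
    then obtain k where k: "i = Suc k" "k \<le> 3" by (cases i) auto
    have "4 + 1 - i = 4 - k" using k by simp
    then have c: "(of_nat (i * (4 + 1 - i)) :: 'k) = (of_nat k + 1) * (4 - of_nat k)"
      using k(2) unfolding k(1) by (simp only: of_nat_mult) (simp add: of_nat_diff)
    show "(\<lambda>b. lin (word_act SE) (w i) b - of_nat (i * (4 + 1 - i)) * w (i - 1) b) \<in> {\<lambda>_. 0}"
      unfolding w lin_scale[OF fin] E c using k(1) by (simp add: algebra_simps)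
  qed (use TU ind in \<open>auto simp: w lin_scale[OF fin] F H E v5 vm algebra_simps\<close>)
qed

section \<open>Normal words\<close>

primrec ads :: "('i,'j) gen list \<Rightarrow> adjb list" where
  "ads [] = []"
| "ads (x # u) = (case x of Tr i \<Rightarrow> ads u | Ad j y \<Rightarrow> y # ads u)"

primrec ty :: "('i,'j) gen \<Rightarrow> 'i + 'j" where
  "ty (Tr i) = Inl i"
| "ty (Ad j x) = Inr j"

text \<open>Rewriting preserves types, so a trivial letter is compared only with itself and may
  share the rank of f.\<close>

fun rk :: "('i,'j) gen \<Rightarrow> nat" where
  "rk (Tr i) = 0"
| "rk (Ad j AF) = 0"
| "rk (Ad j AH) = 1"
| "rk (Ad j AE) = 2"

primrec awt :: "adjb \<Rightarrow> int" where
  "awt AE = 2" | "awt AH = 0" | "awt AF = -2"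

definition wt :: "('i,'j) gen list \<Rightarrow> int" where
  "wt u = sum_list (map awt (ads u))"

text \<open>The bad pairs ee, eh, ef, hf, ff are the leading words of the five relations for f < h <
  e.\<close>

abbreviation good :: "adjb \<Rightarrow> adjb \<Rightarrow> bool" where
  "good x y \<equiv> x \<noteq> AE \<and> y \<noteq> AF"

definition nrm :: "('i,'j) gen list \<Rightarrow> bool" where
  "nrm u \<longleftrightarrow> successively good (ads u)"

lemma ads_append [simp]: "ads (u @ v) = ads u @ ads v"
  by (induction u) (auto split: gen.split)

lemma ads_eq_Nil_iff: "ads u = [] \<longleftrightarrow> set u \<subseteq> range Tr"
  by (induction u) (auto split: gen.split)

lemma ads_eq_ConsD:
  "ads u = y # ys \<Longrightarrow> \<exists>a j q. u = a @ Ad j y # q \<and> set a \<subseteq> range Tr \<and> ads q = ys"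
proof (induction u)
  case (Cons z u)
  show ?case
  proof (cases z)
    case (Tr i)
    then obtain a j q where "u = a @ Ad j y # q" "set a \<subseteq> range Tr" "ads q = ys"
      using Cons by auto
    then have "z # u = (z # a) @ Ad j y # q \<and> set (z # a) \<subseteq> range Tr \<and> ads q = ys"
      using Tr by simp
    then show ?thesis by blast
  next
    case (Ad j x)
    then have "z # u = [] @ Ad j y # u \<and> set [] \<subseteq> range Tr \<and> ads u = ys"
      using Cons by simp
    then show ?thesis by blast
  qed
qed simp

lemma not_nrmE:
  assumes "\<not> nrm u"
  obtains p j x a j' y q where "u = p @ Ad j x # a @ Ad j' y # q" "set a \<subseteq> range Tr" "\<not> good x y"
proof -
  have "\<exists>p j x a j' y q. u = p @ Ad j x # a @ Ad j' y # q \<and> set a \<subseteq> range Tr \<and> \<not> good x y"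
    using assms
  proof (induction u)
    case (Cons z u)
    show ?case
    proof (cases "nrm u")
      case False
      with Cons.IH obtain p j x a j' y q
        where "u = p @ Ad j x # a @ Ad j' y # q" "set a \<subseteq> range Tr" "\<not> good x y" by blast
      then have "z # u = (z # p) @ Ad j x # a @ Ad j' y # q" by simp
      then show ?thesis using \<open>set a \<subseteq> range Tr\<close> \<open>\<not> good x y\<close> by blast
    next
      case True
      then obtain j x where z: "z = Ad j x"
        using Cons.prems by (cases z) (auto simp: nrm_def)
      obtain y ys where y: "ads u = y # ys" "\<not> good x y"
        using Cons.prems True z by (cases "ads u") (auto simp: nrm_def)
      obtain a j' q where "u = a @ Ad j' y # q" "set a \<subseteq> range Tr"
        using ads_eq_ConsD[OF y(1)] by blast
      then have "z # u = [] @ Ad j x # a @ Ad j' y # q" using z by simp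
      then show ?thesis using \<open>set a \<subseteq> range Tr\<close> y(2) by blast
    qed
  qed (simp add: nrm_def)
  then show ?thesis using that by blast
qed

text \<open>With good neighbours e can only stand last and f only first, which leaves h in
  between.\<close>

lemma successively_good_cases:
  assumes "successively good xs"
  obtains k where "xs = replicate k AH" | k where "xs = replicate k AH @ [AE]"
  | k where "xs = AF # replicate k AH" | k where "xs = AF # replicate k AH @ [AE]"
proof -
  have "\<exists>k. xs = replicate k AH \<or> xs = replicate k AH @ [AE]
      \<or> xs = AF # replicate k AH \<or> xs = AF # replicate k AH @ [AE]"
    using assms
  proof (induction xs)
    case Nil
    then show ?case by (intro exI[of _ 0]) simp
  next
    case (Cons x xs)
    then have s: "successively good xs" by (cases xs) auto
    then obtain k where k: "xs = replicate k AH \<or> xs = replicate k AH @ [AE]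
      \<or> xs = AF # replicate k AH \<or> xs = AF # replicate k AH @ [AE]" using Cons by blast
    show ?case
    proof (cases "xs = []")
      case True
      then show ?thesis by (intro exI[of _ "if x = AH then 1 else 0"]) (cases x; simp)
    next
      case False
      then have "x \<noteq> AE" "hd xs \<noteq> AF" using Cons.prems by (cases xs; simp)+
      then have "x = AH \<or> x = AF" "xs = replicate k AH \<or> xs = replicate k AH @ [AE]"
        using k by (cases x; auto)+
      then show ?thesis by (intro exI[of _ "if x = AH then Suc k else k"]) auto
    qed
  qed
  then show ?thesis using that by blast
qed

text \<open>The inner letters h have weight 0, so only the ends count. This bound is why the
  relations of type L(4) already remove every L(m) with m > 2.\<close>

lemma nrm_wt: "nrm u \<Longrightarrow> wt u \<in> {-2, 0, 2}"
  unfolding nrm_def wt_def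
  by (erule successively_good_cases) (auto simp: sum_list_replicate)

lemma mem_gens_iff_ty: "x \<in> gens I J \<longleftrightarrow> ty x \<in> Inl ` I \<union> Inr ` J"
  by (cases x) auto

section \<open>Rewriting modulo the ideal\<close>

lemma subsp_ideal: "subsp (ideal_I I J)"
  by (simp add: ideal_I_def subsp_fspan)

text \<open>Up to sign the five vectors are the relations ee, eh + he, hh - ef - fe, hf + fh, ff,
  with \<open>a\<close> in the middle and \<open>p\<close>, \<open>q\<close> around.\<close>

lemma tau_in_ideal:
  assumes "set a \<subseteq> range Tr" "set (p @ Ad j x # a @ Ad j' y # q) \<subseteq> gens I J" "0 \<le> d" "d \<le> 4"
  shows "fl (map (\<lambda>(c, t). (c, p @ concat t @ q)) (tauL [([], j), (a, j')] d))
     \<in> (ideal_I I J :: (_ \<Rightarrow> 'k::field_char_0) set)"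
proof -
  define v :: "('a,'b) gen list \<Rightarrow> 'k" where "v = fl (map (\<lambda>(c, t). (c, concat t)) (tauL [([], j), (a, j')] d))"
  define w :: "nat \<Rightarrow> ('a,'b) gen list \<Rightarrow> 'k" where "w = (\<lambda>i::nat. \<lambda>b. of_nat (fact i) *
     fl (map (\<lambda>(c, t). (c, concat t)) (tauL [([], j), (a, j')] (int i))) b)"
  have L: "is_Lcopy (\<lambda>x. lin (word_act x)) (TU I J) {\<lambda>_. 0} 4 w"
    unfolding w_def by (rule L4_copy) (use assms in auto)
  obtain i where i: "d = int i" "i \<le> 4" using assms(3,4) by (metis of_nat_le_iff of_nat_numeral zero_le_imp_eq_int)
  have "v = (\<lambda>b. inverse (of_nat (fact i)) * w i b)"
    by (simp add: v_def w_def i mult.assoc[symmetric])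
  moreover have "w i \<in> fspan (w ` {..4})" using i by (intro fspan_base) simp
  ultimately have "v \<in> fspan (w ` {..4})" using subsp_scale[OF subsp_fspan] by metis
  then have "v \<in> isogen I J" unfolding isogen_def using L
    by (intro CollectI exI[of _ 4] exI[of _ w]) simp
  then have "shift p q v \<in> ideal_I I J" unfolding ideal_I_def
    using assms(2) by (intro fspan_base CollectI exI[of _ p] exI[of _ q] exI[of _ v]) simp
  also have "shift p q v = fl (map (\<lambda>(c, t). (c, p @ concat t @ q)) (tauL [([], j), (a, j')] d))"
    unfolding v_def shift_fl map_map comp_def case_prod_beta by simp
  finally show ?thesis .
qed

text \<open>One rewriting step at a bad pair. Termination, invariance of the \<open>Rel\<close>
  functionals and congruence modulo the ideal are recorded for one and the same list, since the
  later inductions combine them.\<close>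

lemma reduction:
  fixes u :: "('i,'j) gen list"
  assumes "\<not> nrm u"
  obtains L :: "('k::field_char_0 \<times> ('i,'j) gen list) list"
  where "\<And>c v. (c, v) \<in> set L \<Longrightarrow> map ty v = map ty u \<and> wt v = wt u \<and> (map rk v, map rk u) \<in> lex less_than"
    and "\<And>\<phi>. Rel \<phi> \<Longrightarrow> \<phi> u = ev L \<phi>"
    and "\<And>I J. set u \<subseteq> gens I J \<Longrightarrow> (\<lambda>w. single u 1 w - fl L w) \<in> ideal_I I J"
proof -
  obtain p j x a j' y q where u: "u = p @ Ad j x # a @ Ad j' y # q"
    and a: "set a \<subseteq> range Tr" and bad: "\<not> good x y"
    using not_nrmE[OF assms] by metis
  define W where "W x y = p @ Ad j x # a @ Ad j' y # q" for x y
  have u': "u = W x y" by (simp add: u W_def)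
  have ty: "map ty (W x y) = map ty (W x' y')" for x y x' y' by (simp add: W_def)
  have wt: "awt x + awt y = awt x' + awt y' \<Longrightarrow> wt (W x y) = wt (W x' y')" for x y x' y'
    using a by (simp add: W_def wt_def)
  have lex: "(map rk (W x y), map rk (W x' y')) \<in> lex less_than" if "rk (Ad j x :: ('i,'j) gen) < rk (Ad j x' :: ('i,'j) gen)" for x y x' y'
    unfolding W_def map_append list.map using that
    by (intro lex_append_leftI) simp
  have rel: "relations (\<lambda>x y. \<phi> (W x y))" if "Rel \<phi>" for \<phi> :: "_ \<Rightarrow> 'k"
    using RelD[OF that a] by (simp add: W_def)
  have id: "(\<lambda>w. fl (map (\<lambda>(c, t). (c, p @ concat t @ q)) (tauL [([], j), (a, j')] d)) w)
      \<in> (ideal_I I J :: (_ \<Rightarrow> 'k) set)"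
    if "set u \<subseteq> gens I J" "0 \<le> d" "d \<le> 4" for I J d
    using tau_in_ideal[OF a that(1)[unfolded u] that(2,3)] by simp
  \<comment> \<open>For d = 1 and d = 2 the leading words eh and ef have coefficient -1, so there
    the negative vector is used.\<close>
  have id': "(\<lambda>w. - fl (map (\<lambda>(c, t). (c, p @ concat t @ q)) (tauL [([], j), (a, j')] d)) w)
      \<in> (ideal_I I J :: (_ \<Rightarrow> 'k) set)"
    if "set u \<subseteq> gens I J" "0 \<le> d" "d \<le> 4" for I J d
    using subsp_scale[OF subsp_ideal id[OF that], of "-1"] by simp
  note simps = fl_Cons fl_Nil W_def
  consider "x = AE" "y = AE" | "x = AE" "y = AH" | "x = AE" "y = AF" | "x = AH" "y = AF" | "x = AF" "y = AF"
    using bad by (cases x; cases y) auto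
  then show ?thesis
  proof cases
    case 1
    show ?thesis
    proof (rule that[of "[]"])
      fix I J assume "set u \<subseteq> gens I J"
      from id[OF this, of 0] show "(\<lambda>w. single u 1 w - fl [] w) \<in> (ideal_I I J :: (_ \<Rightarrow> 'k) set)"
        unfolding u' 1 by (simp add: simps)
    qed (use rel in \<open>auto simp: u' 1 relations_def\<close>)
  next
    case 2
    show ?thesis
    proof (rule that[of "[(-1, W AH AE)]"])
      fix I J assume "set u \<subseteq> gens I J"
      from id'[OF this, of 1] show "(\<lambda>w. single u 1 w - fl [(-1, W AH AE)] w) \<in> (ideal_I I J :: (_ \<Rightarrow> 'k) set)"
        unfolding u' 2 by (simp add: simps algebra_simps)
    qed (use rel in \<open>auto simp: u' 2 relations_def eq_neg_iff_add_eq_0 intro!: ty wt lex\<close>)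
  next
    case 3
    show ?thesis
    proof (rule that[of "[(1, W AH AH), (-1, W AF AE)]"])
      fix I J assume "set u \<subseteq> gens I J"
      from id'[OF this, of 2] show "(\<lambda>w. single u 1 w - fl [(1, W AH AH), (-1, W AF AE)] w) \<in> (ideal_I I J :: (_ \<Rightarrow> 'k) set)"
        unfolding u' 3 by (simp add: simps algebra_simps)
    qed (use rel in \<open>auto simp: u' 3 relations_def eq_diff_eq intro!: ty wt lex\<close>)
  next
    case 4
    show ?thesis
    proof (rule that[of "[(-1, W AF AH)]"])
      fix I J assume "set u \<subseteq> gens I J"
      from id[OF this, of 3] show "(\<lambda>w. single u 1 w - fl [(-1, W AF AH)] w) \<in> (ideal_I I J :: (_ \<Rightarrow> 'k) set)"
        unfolding u' 4 by (simp add: simps algebra_simps)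
    qed (use rel in \<open>auto simp: u' 4 relations_def eq_neg_iff_add_eq_0 intro!: ty wt lex\<close>)
  next
    case 5
    show ?thesis
    proof (rule that[of "[]"])
      fix I J assume "set u \<subseteq> gens I J"
      from id[OF this, of 4] show "(\<lambda>w. single u 1 w - fl [] w) \<in> (ideal_I I J :: (_ \<Rightarrow> 'k) set)"
        unfolding u' 5 by (simp add: simps)
    qed (use rel in \<open>auto simp: u' 5 relations_def\<close>)
  qed
qed

text \<open>Rewriting preserves the weight and terminates in normal words, none of which has such a
  weight.\<close>

lemma Rel_wt:
  fixes \<phi> :: "('i,'j) gen list \<Rightarrow> 'k::field_char_0"
  assumes "Rel \<phi>" "wt u \<notin> {-2, 0, 2}"
  shows "\<phi> u = 0"
proof -
  have "wf (inv_image (lex less_than) (map rk :: ('i,'j) gen list \<Rightarrow> nat list))"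
    by (intro wf_inv_image wf_lex) simp
  then show ?thesis using assms(2)
  proof (induction u rule: wf_induct_rule)
    case (less u)
    then have "\<not> nrm u" using nrm_wt by blast
    then obtain L :: "('k \<times> ('i,'j) gen list) list"
      where L: "\<And>c v. (c, v) \<in> set L \<Longrightarrow> map ty v = map ty u \<and> wt v = wt u \<and> (map rk v, map rk u) \<in> lex less_than"
      and \<phi>: "\<And>\<phi>. Rel \<phi> \<Longrightarrow> \<phi> u = ev L \<phi>" using reduction by metis
    have "ev L \<phi> = 0" by (rule ev_eq_0) (use L less in \<open>auto simp: in_inv_image\<close>)
    then show ?case using \<phi>[OF assms(1)] by simp
  qed
qed

lemma ev_wl_SH: "ev (wl SH w) \<phi> = of_int (wt w) * \<phi> w"
proof (induction w arbitrary: \<phi>)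
  case (Cons y w)
  show ?case
  proof (cases y)
    case (Ad j x)
    then show ?thesis unfolding ev_wl_Cons Cons by (cases x) (auto simp: wt_def algebra_simps)
  qed (simp add: ev_wl_Cons Cons wt_def del: wl.simps)
qed (simp add: wt_def)

text \<open>A functional satisfying the relations kills the highest weight vector by
  \<open>Rel_wt\<close>. The rest of the copy is reached by F, whose transpose preserves
  \<open>Rel\<close>.\<close>

lemma isogen_annihilated:
  fixes g :: "('i,'j) gen list \<Rightarrow> 'k::field_char_0"
  assumes "g \<in> isogen I J" "Rel \<phi>"
  shows "fin_supp g \<and> pair g \<phi> = 0"
proof -
  obtain m w where m: "m \<noteq> 0" "m \<noteq> 2" and g: "g \<in> fspan (w ` {..m})"
    and L: "is_Lcopy (\<lambda>x. lin (word_act x)) (TU I J) {\<lambda>_. 0} m w"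
    using assms(1) unfolding isogen_def by auto
  have fin: "fin_supp (w i)" if "i \<le> m" for i
    using L that unfolding is_Lcopy_def TU_def by auto
  have F: "w (Suc i) = lin (word_act SF) (w i)" if "i < m" for i
    using L that unfolding is_Lcopy_def by (auto simp: fun_eq_iff)
  have H: "lin (word_act SH) (w 0) = (\<lambda>b. of_nat m * w 0 b)"
    using L unfolding is_Lcopy_def by (auto simp: fun_eq_iff)
  \<comment> \<open>Words are weight vectors, so \<open>w 0\<close> is supported on words of weight
    m; in characteristic zero the two integers can be compared in the field.\<close>
  have wt0: "wt b = int m" if "w 0 b \<noteq> 0" for b
  proof -
    have "lin (word_act SH) (w 0) b = pair (w 0) (\<lambda>a. of_int (wt b) * single b 1 a)"
      unfolding lin_eq_pair word_act_fl fl_def ev_wl_SH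
      by (rule arg_cong[of _ _ "pair (w 0)"]) (auto simp: single_def)
    then have "of_nat m * w 0 b = of_int (wt b) * w 0 b"
      unfolding H pair_scale_right pair_delta[OF fin[of 0, simplified]] .
    then have "of_int (wt b) = (of_int (int m) :: 'k)" using that by simp
    then show ?thesis unfolding of_int_eq_iff .
  qed
  have "pair (w i) \<phi> = 0" if "i \<le> m" "Rel \<phi>" for i \<phi>
    using that
  proof (induction i arbitrary: \<phi>)
    case 0
    have "\<phi> b = 0" if "w 0 b \<noteq> 0" for b
      using Rel_wt[OF 0(2), of b] wt0[OF that] m by auto
    then show ?case unfolding pair_def by (intro sum.neutral) auto
  next
    case (Suc i)
    have "pair (w (Suc i)) \<phi> = pair (w i) (\<lambda>a. ev (wl SF a) \<phi>)"
      using Suc.prems F[of i] pair_lin[OF fin word_act_fl, of i] by simp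
    then show ?case using Suc.IH[OF _ Rel_wl[OF Suc.prems(2)]] Suc.prems by simp
  qed
  then have "w ` {..m} \<subseteq> {z. fin_supp z \<and> (\<forall>g\<in>{\<phi>}. pair z g = 0)}"
    using fin assms(2) by auto
  then show ?thesis using fspan_subset[OF subsp_annihilator] g by blast
qed

lemma ideal_annihilated:
  fixes g :: "('i,'j) gen list \<Rightarrow> 'k::field_char_0"
  assumes "g \<in> ideal_I I J"
  shows "fin_supp g" "\<And>\<phi>. Rel \<phi> \<Longrightarrow> pair g \<phi> = 0" "g [] = 0"
proof -
  have "ideal_I I J \<subseteq> {z. fin_supp z \<and> (\<forall>g\<in>Collect Rel. pair z (g :: _ \<Rightarrow> 'k) = 0)}"
    unfolding ideal_I_def
  proof (rule fspan_subset[OF subsp_annihilator], safe)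
    fix u u' :: "('i,'j) gen list" and g :: "('i,'j) gen list \<Rightarrow> 'k"
    assume "g \<in> isogen I J"
    note g = isogen_annihilated[OF this]
    have fin: "fin_supp g" using g[OF Rel_zero] ..
    show "fin_supp (shift u u' g)" by (rule fin_supp_shift_pair(1)[OF fin])
    fix \<phi> :: "('i,'j) gen list \<Rightarrow> 'k" assume "Rel \<phi>"
    then show "pair (shift u u' g) \<phi> = 0"
      unfolding fin_supp_shift_pair(2)[OF fin] using g[OF Rel_context] by blast
  qed
  then show 1: "fin_supp g" and 2: "\<And>\<phi>. Rel \<phi> \<Longrightarrow> pair g \<phi> = 0" using assms by auto
  \<comment> \<open>Every word in a relation is nonempty, so the delta functional at the empty word
    satisfies them all; hence the ideal lies in the augmentation ideal.\<close>
  have "Rel (single [] 1 :: ('i,'j) gen list \<Rightarrow> 'k)"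
    by (simp add: Rel_def relations_def single_def)
  from 2[OF this] show "g [] = 0" using pair_delta[OF 1] by simp
qed

section \<open>Coordinates with respect to normal words\<close>

text \<open>The standard representation of sl2 sends a word to a product of 2 by 2 matrices; its entries
  satisfy the relations, and together with the types of the letters they determine the class of a
  word. A normal sequence f?h*e? is recognised by its first and last letter.\<close>

primrec mat :: "adjb list \<Rightarrow> bool \<Rightarrow> bool \<Rightarrow> 'k::comm_ring_1" where
  "mat [] r c = (if r = c then 1 else 0)"
| "mat (x # xs) r c = (case x of AH \<Rightarrow> (if r then - mat xs r c else mat xs r c)
     | AE \<Rightarrow> (if r then 0 else mat xs True c) | AF \<Rightarrow> (if r then mat xs False c else 0))"

lemma mat_append: "mat (xs @ ys) r c = mat xs r False * mat ys False c + mat xs r True * mat ys True c"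
  by (induction xs arbitrary: r) (auto split: adjb.split)

lemma mat_replicate: "mat (replicate k AH) r c = (if r = c then if r then (-1) ^ k else 1 else 0)"
  by (induction k) auto

lemma relations_mat: "relations (\<lambda>x y. mat (p @ x # y # q) r c)"
  by (simp add: relations_def mat_append)

text \<open>The index \<open>False\<close> is the highest weight vector. The normal sequences h^m,
  h^(m-1) e, f h^(m-1), f h^(m-2) e of length m have as matrices diag(1, (-1)^m) and the three other
  matrix units. So each coordinate is a matrix entry, corrected in the last case by the contribution
  of h^m.\<close>

definition acoord :: "adjb list \<Rightarrow> adjb list \<Rightarrow> 'k::comm_ring_1" where
  "acoord ys xs = (let F = (ys \<noteq> [] \<and> hd ys = AF); E = (ys \<noteq> [] \<and> last ys = AE) in
     if F \<and> E then mat xs True True - (-1) ^ length ys * mat xs False False else mat xs F E)"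

lemma replicate_AH_snoc_neq: "replicate k AH @ [AE] \<noteq> AH # replicate k' AH"
proof
  assume eq: "replicate k AH @ [AE] = AH # replicate k' AH"
  have "AE \<in> set (replicate k AH @ [AE])" by simp
  then show False unfolding eq by (auto split: if_splits)
qed

lemma acoord_normal:
  assumes "successively good xs" "successively good ys" "length xs = length ys"
  shows "acoord ys xs = (if xs = ys then 1 else 0)"
  using assms(3)
  by (cases rule: successively_good_cases[OF assms(1)]; cases rule: successively_good_cases[OF assms(2)])
    (auto simp: acoord_def Let_def mat_append mat_replicate hd_append replicate_AH_snoc_neq
      replicate_AH_snoc_neq[symmetric])

lemma relations_if: "relations E \<Longrightarrow> relations F \<Longrightarrow> relations (\<lambda>x y. if P then E x y else F x y)"
  by (cases P) simp_all

lemma relations_acoord: "relations (\<lambda>x y. acoord ys (p @ x # y # q))"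
  unfolding acoord_def Let_def
  by (intro relations_if relations_diff relations_scale relations_mat)

definition coord :: "('i,'j) gen list \<Rightarrow> ('i,'j) gen list \<Rightarrow> 'k::comm_ring_1" where
  "coord v u = (if map ty u = map ty v then acoord (ads v) (ads u) else 0)"

lemma Rel_coord: "Rel (coord v)"
  unfolding Rel_def
proof (intro allI impI)
  fix p a q and j j' :: 'b assume "set a \<subseteq> range (Tr :: 'a \<Rightarrow> ('a,'b) gen)"
  then have "ads a = []" by (simp add: ads_eq_Nil_iff)
  \<comment> \<open>The type of the word does not depend on \<open>x\<close> and \<open>y\<close>,
    so one case distinction, made at the letters e, e, covers all of them.\<close>
  then show "relations (\<lambda>x y. coord v (p @ Ad j x # a @ Ad j' y # q) :: 'c)"
    using relations_acoord[of "ads v" "ads p" "ads q"]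
    by (cases "map ty v = map ty (p @ Ad j AE # a @ Ad j' AE # q)") (auto simp: coord_def relations_def)
qed

lemma ty_ads_inj: "map ty u = map ty v \<Longrightarrow> ads u = ads v \<Longrightarrow> u = v"
proof (induction u arbitrary: v)
  case (Cons x u)
  then obtain y v' where v: "v = y # v'" by auto
  show ?case using Cons.prems Cons.IH[of v'] unfolding v by (cases x; cases y) auto
qed simp

lemma length_ads: "map ty u = map ty v \<Longrightarrow> length (ads u) = length (ads v)"
proof (induction u arbitrary: v)
  case (Cons x u)
  then obtain y v' where v: "v = y # v'" by auto
  show ?case using Cons.prems Cons.IH[of v'] unfolding v by (cases x; cases y) auto
qed simp

text \<open>Together with \<open>Rel_coord\<close> this gives functionals on the quotient dual to
  the normal words, which are therefore independent there.\<close>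

lemma coord_normal: "nrm u \<Longrightarrow> nrm v \<Longrightarrow> coord v u = (if u = v then 1 else 0)"
  using ty_ads_inj[of u v] length_ads[of u v] acoord_normal[of "ads u" "ads v"]
  by (auto simp: coord_def nrm_def)

fun coordT :: "('i,'j) gen list list \<Rightarrow> ('i,'j) gen list list \<Rightarrow> 'k::comm_ring_1" where
  "coordT [] [] = 1"
| "coordT (v # t) (u # s) = coord v u * coordT t s"
| "coordT _ _ = 0"

definition nrmT :: "('i,'j) gen list list \<Rightarrow> bool" where
  "nrmT t \<longleftrightarrow> (\<forall>w\<in>set t. nrm w)"

lemma RelT_coordT: "RelT (coordT t :: _ \<Rightarrow> 'k::comm_ring_1)"
proof -
  have "Rel (\<lambda>w. coordT t (s @ w # s') :: 'k)" for s s'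
  proof (induction s arbitrary: t)
    case Nil
    then show ?case by (cases t) (auto intro: Rel_zero Rel_scale_right Rel_coord)
  next
    case (Cons u s)
    then show ?case by (cases t) (auto intro: Rel_zero Rel_scale)
  qed
  then show ?thesis by (simp add: RelT_def)
qed

lemma coordT_normal: "nrmT s \<Longrightarrow> nrmT t \<Longrightarrow> coordT t s = (if s = t then 1 else 0)"
  by (induction t s rule: coordT.induct) (auto simp: nrmT_def coord_normal)

section \<open>Tuples with one entry in the ideal\<close>

lemma slot_eq:
  assumes "g [] = 0" "i < length u"
  shows "slot i u g (u[i := w]) = g w"
  using assms by (auto simp: slot_def)

lemma slot_outside:
  assumes "\<And>w. t \<noteq> u[i := w]"
  shows "slot i u g t = 0"
proof (rule ccontr)
  assume "slot i u g t \<noteq> 0"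
  then have h: "length t = length u" "\<And>k. k < length u \<Longrightarrow> k \<noteq> i \<Longrightarrow> t ! k = u ! k"
    by (auto simp: slot_def split: if_splits)
  have "t = u[i := t ! i]"
  proof (rule nth_equalityI)
    fix k assume "k < length t"
    then show "t ! k = u[i := t ! i] ! k" using h by (cases "k = i") simp_all
  qed (simp add: h)
  then show False using assms by blast
qed

text \<open>Rewriting a single entry changes the tuple by an element of the ideal placed in one
  slot, that is by a generator of \<open>Jsp\<close>.\<close>

lemma reductionT:
  fixes t :: "('i,'j) gen list list"
  assumes "\<not> nrmT t"
  obtains L :: "('k::field_char_0 \<times> ('i,'j) gen list list) list"
  where "\<And>c s. (c, s) \<in> set L \<Longrightarrow> map (map ty) s = map (map ty) t
        \<and> (map rk (concat s), map rk (concat t)) \<in> lex less_than"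
    and "\<And>g. RelT g \<Longrightarrow> g t = ev L g"
    and "\<And>I J n. t \<in> tuples I J n \<Longrightarrow> (\<lambda>w. single t 1 w - fl L w) \<in> Jsp I J n"
proof -
  obtain p u q where t: "t = p @ u # q" and u: "\<not> nrm u"
    using assms unfolding nrmT_def by (meson split_list)
  obtain L :: "('k \<times> ('i,'j) gen list) list" where
    L: "\<And>c v. (c, v) \<in> set L \<Longrightarrow> map ty v = map ty u \<and> wt v = wt u \<and> (map rk v, map rk u) \<in> lex less_than"
    and R: "\<And>\<phi>. Rel \<phi> \<Longrightarrow> \<phi> u = ev L \<phi>"
    and id: "\<And>I J. set u \<subseteq> gens I J \<Longrightarrow> (\<lambda>w. single u 1 w - fl L w) \<in> ideal_I I J"
    by (rule reduction[OF u]) (rule that; blast)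
  let ?M = "map (\<lambda>(c, v). (c, p @ v # q)) L"
  show ?thesis
  proof (rule that[of ?M])
    fix c s assume "(c, s) \<in> set ?M"
    then obtain v where "(c, v) \<in> set L" and s: "s = p @ v # q" by auto
    from L[OF this(1)] show "map (map ty) s = map (map ty) t
        \<and> (map rk (concat s), map rk (concat t)) \<in> lex less_than"
      by (auto simp: s t intro!: lex_append_leftI lex_append_rightI)
  next
    fix g :: "('i,'j) gen list list \<Rightarrow> 'k" assume "RelT g"
    then show "g t = ev ?M g" using R[OF RelTD[of g p q]] by (simp add: t ev_map)
  next
    fix I J n assume tup: "t \<in> tuples I J n"
    have "u \<noteq> []" using u by (auto simp: nrm_def)
    let ?g = "\<lambda>w. single u 1 w - fl L w :: 'k"
    have "(\<lambda>w. single t 1 w - fl ?M w) = slot (length p) t ?g"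
    proof
      fix s
      show "single t 1 s - fl ?M s = slot (length p) t ?g s"
      proof (cases "\<exists>w. s = p @ w # q")
        case True
        then obtain w where s: "s = p @ w # q" by blast
        \<comment> \<open>\<open>slot\<close> drops tuples with an empty entry in position i, so the
          two sides agree there only because \<open>?g\<close> vanishes at the empty word.\<close>
        have "?g [] = 0" using id tup ideal_annihilated(3) unfolding t tuples_def by fastforce
        then show ?thesis unfolding s
          by (auto simp: slot_def t fl_def ev_map single_def nth_append nth_Cons')
      next
        case False
        have "ev L (\<lambda>v. single s 1 (p @ v # q)) = 0"
          by (rule ev_eq_0) (use False in \<open>auto simp: single_def\<close>)
        moreover have "slot (length p) t ?g s = 0"
          by (rule slot_outside) (use False in \<open>simp add: t\<close>)
        ultimately show ?thesis using False by (auto simp: fl_def ev_map single_def t)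
      qed
    qed
    also have "\<dots> \<in> Jsp I J n" unfolding Jsp_def
      using tup id[of I J]
      by (intro fspan_base CollectI exI[of _ "length p"] exI[of _ t] exI[of _ ?g])
        (auto simp: tuples_def t)
    finally show "(\<lambda>w. single t 1 w - fl ?M w) \<in> Jsp I J n" .
  qed
qed

section \<open>The bar complex\<close>

lemma tuples_cong_ty:
  assumes "map (map ty) s = map (map ty) t"
  shows "s \<in> tuples I J n \<longleftrightarrow> t \<in> tuples I J n"
proof -
  have "t \<in> tuples I J n \<longleftrightarrow> length (map (map ty) t) = n \<and>
     (\<forall>w\<in>set (map (map ty) t). w \<noteq> [] \<and> set w \<subseteq> Inl ` I \<union> Inr ` J)" for t :: "('a,'b) gen list list"
    unfolding tuples_def subset_iff by (auto simp: mem_gens_iff_ty)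
  then show ?thesis using assms by metis
qed

lemma subsp_Bsp: "subsp (Bsp I J n)"
  unfolding subsp_def Bsp_def by (auto intro: fin_supp_add fin_supp_scale) (metis add_0)+

lemma single_in_Bsp: "t \<in> tuples I J n \<Longrightarrow> single t c \<in> Bsp I J n"
  by (auto simp: Bsp_def single_def[abs_def] fin_supp_single[unfolded single_def])

lemma Bsp_in_subsp:
  assumes "subsp V" "z \<in> Bsp I J n" "\<And>t. t \<in> tuples I J n \<Longrightarrow> single t 1 \<in> V"
  shows "z \<in> V"
  by (rule fin_supp_in_subsp[OF assms(1)]) (use assms in \<open>simp_all add: Bsp_def\<close>)

lemma fin_supp_Bsp: "z \<in> Bsp I J n \<Longrightarrow> fin_supp z"
  by (simp add: Bsp_def)

lemma subsp_Jsp: "subsp (Jsp I J n)"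
  by (simp add: Jsp_def subsp_fspan)

lemma slot_supp:
  assumes "g [] = 0" "i < length u"
  shows "{t. slot i u g t \<noteq> 0} = (\<lambda>w. u[i := w]) ` {w. g w \<noteq> 0}"
proof (intro equalityI subsetI)
  fix t assume t: "t \<in> {t. slot i u g t \<noteq> 0}"
  then obtain w where "t = u[i := w]" using slot_outside by blast
  then show "t \<in> (\<lambda>w. u[i := w]) ` {w. g w \<noteq> 0}" using t slot_eq[of g i u, OF assms] by auto
qed (auto simp: slot_eq[of g i u, OF assms])

lemma pair_slot:
  assumes "g [] = 0" "i < length u"
  shows "pair (slot i u g) h = pair g (\<lambda>w. h (u[i := w]))"
proof -
  have inj: "inj_on (\<lambda>w. u[i := w]) A" for A
    using assms(2) by (metis inj_onI nth_list_update_eq)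
  show ?thesis unfolding pair_def slot_supp[of g i u, OF assms]
    by (simp add: sum.reindex[OF inj] slot_eq[of g i u, OF assms])
qed

lemma ideal_supp:
  assumes "g \<in> ideal_I I J" "g w \<noteq> 0"
  shows "set w \<subseteq> gens I J"
proof -
  let ?V = "{g. \<forall>w. g w \<noteq> (0::'c) \<longrightarrow> set w \<subseteq> gens I J}"
  have V: "subsp ?V" unfolding subsp_def by (auto, metis add_0 subsetD)
  have "isogen I J \<subseteq> ?V"
  proof
    fix g :: "('a, 'b) gen list \<Rightarrow> 'c" assume "g \<in> isogen I J"
    then obtain m w where g: "g \<in> fspan (w ` {..m})"
      and L: "is_Lcopy (\<lambda>x. lin (word_act x)) (TU I J) {\<lambda>_. 0} m w"
      unfolding isogen_def by auto
    have "w ` {..m} \<subseteq> ?V" using L unfolding is_Lcopy_def TU_def by auto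
    then show "g \<in> ?V" using fspan_subset[OF V] g by blast
  qed
  have "ideal_I I J \<subseteq> ?V" unfolding ideal_I_def
  proof (rule fspan_subset[OF V], clarify)
    fix u u' w x and g :: "('a, 'b) gen list \<Rightarrow> 'c"
    assume h: "set u \<subseteq> gens I J" "set u' \<subseteq> gens I J" "g \<in> isogen I J" "shift u u' g w \<noteq> 0" "x \<in> set w"
    obtain m where m: "w = u @ m @ u'" using h(4) shift_outside by metis
    then have "g m \<noteq> 0" using h(4) by (simp add: shift_append)
    then have "set m \<subseteq> gens I J" using h(3) \<open>isogen I J \<subseteq> ?V\<close> by blast
    then show "x \<in> gens I J" using h m by auto
  qed
  then show ?thesis using assms by blast
qed

section \<open>The relations between tuples as an annihilator\<close>

lemma Jsp_subset:
  "Jsp I J n \<subseteq> {z \<in> Bsp I J n. \<forall>g. RelT g \<longrightarrow> pair z g = (0 :: 'k::field_char_0)}"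
proof -
  let ?V = "{z \<in> Bsp I J n. \<forall>g. RelT g \<longrightarrow> pair z g = (0 :: 'k)}"
  have "subsp ?V"
    unfolding subsp_def
    by (auto intro: subsp_zero[OF subsp_Bsp] subsp_add[OF subsp_Bsp] subsp_scale[OF subsp_Bsp]
        simp: pair_add_left pair_scale_left fin_supp_Bsp)
  moreover have "{slot i u g | i u g. i < n \<and> u \<in> tuples I J n \<and> g \<in> ideal_I I J} \<subseteq> ?V"
  proof clarify
    fix i u and g :: "('a, 'b) gen list \<Rightarrow> 'k"
    assume i: "i < n" and u: "u \<in> tuples I J n" and g: "g \<in> ideal_I I J"
    have i': "i < length u" using i u by (simp add: tuples_def)
    note g' = ideal_annihilated[OF g]
    have "fin_supp (slot i u g)"
      unfolding fin_supp_def slot_supp[of g i u, OF g'(3) i'] using g'(1) by (simp add: fin_supp_def)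
    moreover have "t \<in> tuples I J n" if t: "slot i u g t \<noteq> 0" for t
    proof -
      obtain w where w: "t = u[i := w]" "g w \<noteq> 0"
        using t slot_supp[of g i u, OF g'(3) i'] by blast
      then have "w \<noteq> []" "set w \<subseteq> gens I J" using g'(3) ideal_supp[OF g] by auto
      then show ?thesis using u w set_update_subset_insert[of u i w] by (auto simp: tuples_def)
    qed
    moreover have "pair (slot i u g) h = 0" if h: "RelT h" for h
    proof -
      have "Rel (\<lambda>w. h (u[i := w]))"
        using RelTD[OF h, of "take i u" "drop (Suc i) u"] i' by (simp add: upd_conv_take_nth_drop)
      then show ?thesis unfolding pair_slot[of g i u, OF g'(3) i'] by (rule g'(2))
    qed
    ultimately show "slot i u g \<in> Bsp I J n \<and> (\<forall>h. RelT h \<longrightarrow> pair (slot i u g) h = 0)"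
      by (simp add: Bsp_def)
  qed
  ultimately show ?thesis unfolding Jsp_def by (rule fspan_subset)
qed

text \<open>Rewriting lowers the first component. The second one compares different cuttings of one
  word and counts an early merge as large. \<open>lex\<close> relates only lists of equal length,
  which makes both orders well-founded.\<close>

definition tless :: "('i,'j) gen list list rel" where
  "tless = inv_image (lex less_than <*lex*> lex less_than) (\<lambda>t. (map rk (concat t), map length t))"

lemma wf_tless: "wf tless"
  unfolding tless_def by (intro wf_inv_image wf_lex_prod wf_lex wf_less_than)

lemma tless_iff: "(s, t) \<in> tless \<longleftrightarrow> (map rk (concat s), map rk (concat t)) \<in> lex less_than
   \<or> map rk (concat s) = map rk (concat t) \<and> (map length s, map length t) \<in> lex less_than"
  by (simp add: tless_def)

lemma normal_form:
  fixes z :: "('i,'j) gen list list \<Rightarrow> 'k::field_char_0"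
  assumes "z \<in> Bsp I J n"
  shows "z \<in> fspan (Jsp I J n \<union> {single t 1 | t. t \<in> tuples I J n \<and> nrmT t})" (is "_ \<in> ?V")
proof -
  have "single t 1 \<in> ?V" if "t \<in> tuples I J n" for t
    using wf_tless that
  proof (induction t rule: wf_induct_rule)
    case (less t)
    show ?case
    proof (cases "nrmT t")
      case True
      then show ?thesis using less by (intro fspan_base) blast
    next
      case False
      then obtain L :: "('k \<times> ('i,'j) gen list list) list"
        where L: "\<And>c s. (c, s) \<in> set L \<Longrightarrow> map (map ty) s = map (map ty) t
          \<and> (map rk (concat s), map rk (concat t)) \<in> lex less_than"
        and Jt: "(\<lambda>w. single t 1 w - fl L w) \<in> Jsp I J n"
        by (rule reductionT) (rule that; use less.prems in blast)
      have "fl L \<in> ?V"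
      proof (rule fl_in_subsp[OF subsp_fspan])
        fix c s assume "(c, s) \<in> set L"
        from L[OF this] show "single s 1 \<in> ?V"
          using less tuples_cong_ty[of s t I J n] by (simp add: tless_iff)
      qed
      moreover have "(\<lambda>w. single t 1 w - fl L w) \<in> ?V" using Jt by (intro fspan_base) blast
      ultimately have "(\<lambda>w. (single t 1 w - fl L w) + fl L w) \<in> ?V"
        by (intro subsp_add[OF subsp_fspan])
      then show ?thesis by simp
    qed
  qed
  then show ?thesis by (rule Bsp_in_subsp[OF subsp_fspan assms])
qed

text \<open>Write z as an element of \<open>Jsp\<close> plus a combination s of normal tuples. The
  functional \<open>coordT t\<close> kills z and the first summand, and it reads off the coefficient
  of s at t.\<close>

lemma Jsp_eq:
  "Jsp I J n = {z \<in> Bsp I J n. \<forall>g. RelT g \<longrightarrow> pair z g = (0 :: 'k::field_char_0)}"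
proof (intro equalityI Jsp_subset subsetI)
  fix z :: "('a, 'b) gen list list \<Rightarrow> 'k" assume z: "z \<in> {z \<in> Bsp I J n. \<forall>g. RelT g \<longrightarrow> pair z g = 0}"
  let ?N = "{single t 1 :: _ \<Rightarrow> 'k | t. t \<in> tuples I J n \<and> nrmT t}"
  obtain a s where a: "a \<in> Jsp I J n" and s: "s \<in> fspan ?N" and zas: "z = (\<lambda>b. a b + s b)"
    by (rule fspan_UnE[OF normal_form subsp_Jsp]) (use z in auto)
  let ?V = "{s. fin_supp s \<and> (\<forall>t. s t \<noteq> (0::'k) \<longrightarrow> nrmT t)}"
  have "subsp ?V" unfolding subsp_def by (auto intro: fin_supp_add fin_supp_scale) (metis add_0)
  moreover have "?N \<subseteq> ?V" by (auto simp: single_def[abs_def] fin_supp_single[unfolded single_def] split: if_splits)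
  ultimately have sV: "s \<in> ?V" using s fspan_subset by blast
  have "s t = 0" for t
  proof (cases "nrmT t")
    case True
    have "pair z (coordT t) = 0" "pair a (coordT t) = 0"
      using z a Jsp_subset RelT_coordT by blast+
    moreover have "pair z (coordT t) = pair a (coordT t) + pair s (coordT t)"
      unfolding zas using a sV Jsp_subset[of I J n] by (intro pair_add_left) (auto simp: Bsp_def)
    moreover have "pair s (coordT t) = pair s (single t 1)"
      unfolding pair_def using sV True by (intro sum.cong) (auto simp: coordT_normal single_def)
    ultimately show ?thesis using sV pair_delta[of s t] by auto
  qed (use sV in blast)
  then show "z \<in> Jsp I J n" using a zas by simp
qed

section \<open>Compatibility with the action and the differential\<close>

lemma tupl_tuples: "(c, s) \<in> set (tupl x t) \<Longrightarrow> map (map ty) s = map (map ty) t"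
proof (induction t arbitrary: c s)
  case (Cons u t)
  have gl: "(c, b) \<in> set (gl x y) \<Longrightarrow> ty b = ty y" for c b y
    by (cases "(x, y)" rule: gl.cases) auto
  have "(c, w) \<in> set (wl x u) \<Longrightarrow> map ty w = map ty u" for c w
    by (induction u arbitrary: c w) (auto dest: gl)
  then show ?case using Cons by auto
qed simp

lemma Bsp_stable:
  assumes "z \<in> Bsp I J n"
  shows "lin (tup_act x) z \<in> Bsp I J n"
  unfolding lin_fl_eq_sum[where \<phi> = "tup_act x" and L = "tupl x", OF tup_act_fl]
proof (rule subsp_sum[OF subsp_Bsp])
  fix t assume "t \<in> {t. z t \<noteq> 0}"
  then have "t \<in> tuples I J n" using assms by (simp add: Bsp_def)
  then show "fl (tupl x t) \<in> Bsp I J n"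
    by (intro fl_in_subsp[OF subsp_Bsp] single_in_Bsp) (use tupl_tuples tuples_cong_ty in blast)
qed

lemma dl_ConsE:
  assumes "(c, s) \<in> set (dl (u # v # t))"
  obtains "s = (u @ v) # t" | s' where "s = u # s'" "(- c, s') \<in> set (dl (v # t))"
  using assms by auto

lemma dl_props: "(c, s) \<in> set (dl t) \<Longrightarrow> concat s = concat t \<and> Suc (length s) = length t"
proof (induction t arbitrary: c s rule: dl.induct)
  case (3 u v t)
  from 3(2) show ?case
  proof (cases rule: dl_ConsE)
    case (2 s')
    then show ?thesis using 3(1)[OF 2(2)] by simp
  qed simp
qed auto

lemma dl_all:
  assumes "\<And>u v. P u \<Longrightarrow> P v \<Longrightarrow> P (u @ v)"
  shows "(c, s) \<in> set (dl t) \<Longrightarrow> \<forall>u\<in>set t. P u \<Longrightarrow> \<forall>u\<in>set s. P u"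
proof (induction t arbitrary: c s rule: dl.induct)
  case (3 u v t)
  from 3(2) show ?case
  proof (cases rule: dl_ConsE)
    case (2 s')
    then show ?thesis using 3(1)[OF 2(2)] 3(3) by simp
  qed (use 3(3) assms in simp)
qed auto

lemma dl_tuples:
  assumes "(c, s) \<in> set (dl t)" "t \<in> tuples I J (Suc n)"
  shows "s \<in> tuples I J n"
proof -
  have "\<forall>w\<in>set s. w \<noteq> [] \<and> set w \<subseteq> gens I J"
    by (rule dl_all[OF _ assms(1)]) (use assms(2) in \<open>auto simp: tuples_def\<close>)
  then show ?thesis using dl_props[OF assms(1)] assms(2) by (simp add: tuples_def)
qed

lemma Bsp_bar_d:
  assumes "z \<in> Bsp I J (Suc n)"
  shows "lin bar_d z \<in> Bsp I J n"
  unfolding lin_fl_eq_sum[where \<phi> = bar_d and L = dl, OF bar_d_fl]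
proof (rule subsp_sum[OF subsp_Bsp])
  fix t assume "t \<in> {t. z t \<noteq> 0}"
  then have "t \<in> tuples I J (Suc n)" using assms by (simp add: Bsp_def)
  then show "fl (dl t) \<in> Bsp I J n"
    by (intro fl_in_subsp[OF subsp_Bsp] single_in_Bsp) (use dl_tuples in blast)
qed

lemma pair_act: "fin_supp z \<Longrightarrow> pair (lin (tup_act x) z) g = pair z (\<lambda>t. ev (tupl x t) g)"
  by (rule pair_lin[where \<phi> = "tup_act x" and L = "tupl x", OF _ tup_act_fl])

lemma pair_bar_d: "fin_supp z \<Longrightarrow> pair (lin bar_d z) g = pair z (\<lambda>t. ev (dl t) g)"
  by (rule pair_lin[where \<phi> = bar_d and L = dl, OF _ bar_d_fl])

lemma fin_supp_act: "fin_supp (lin (tup_act x) z)"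
  by (rule fin_supp_lin[where L = "tupl x", OF tup_act_fl])

lemma fin_supp_bar_d: "fin_supp (lin bar_d z)"
  by (rule fin_supp_lin[where L = dl, OF bar_d_fl])

lemma bar_d_act: "fin_supp z \<Longrightarrow> lin bar_d (lin (tup_act x) z) = lin (tup_act x) (lin bar_d z)"
  by (rule fin_supp_eqI)
    (simp_all add: fin_supp_act fin_supp_bar_d pair_act pair_bar_d ev_dl_tupl)

lemma bar_d_bar_d: "fin_supp z \<Longrightarrow> lin bar_d (lin bar_d z) = (\<lambda>_. 0)"
  by (rule fin_supp_eqI) (simp_all add: fin_supp_bar_d pair_bar_d ev_dl_dl)

text \<open>In terms of \<open>Jsp_eq\<close>, a subspace of annihilated vectors is stable as soon
  as the transposed operator preserves \<open>RelT\<close>.\<close>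

lemma Jsp_stable: "z \<in> Jsp I J n \<Longrightarrow> lin (tup_act x) z \<in> (Jsp I J n :: (_ \<Rightarrow> 'k::field_char_0) set)"
  unfolding Jsp_eq by (auto intro: Bsp_stable simp: pair_act fin_supp_Bsp RelT_tupl)

lemma Jsp_bar_d:
  "z \<in> Jsp I J (Suc n) \<Longrightarrow> lin bar_d z \<in> (Jsp I J n :: (_ \<Rightarrow> 'k::field_char_0) set)"
  unfolding Jsp_eq by (auto intro: Bsp_bar_d simp: pair_bar_d fin_supp_Bsp RelT_dl)

section \<open>An acyclic matching\<close>

text \<open>The normal tuples index a basis of the bar complex. They are matched as in discrete Morse
  theory: reading a tuple from the left, with c the last block read, a next entry u for which c @ u
  is normal is merged with c; otherwise the shortest prefix b of u with c @ b not normal is split off.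
  Unmatched tuples are chains of blocks, each consisting of trivial letters and one adjoint letter,
  no two consecutive ones forming a normal word.\<close>

definition blk :: "('i,'j) gen list \<Rightarrow> bool" where
  "blk u \<longleftrightarrow> (\<exists>a j x. u = a @ [Ad j x] \<and> set a \<subseteq> range Tr)"

text \<open>Here \<open>c\<close> is the last block read. \<open>mcell\<close> marks the upper
  partners of the matching and \<open>ccell\<close> the critical tuples; by
  \<open>split_cell\<close> the remaining normal tuples are values of \<open>mrg\<close>.\<close>

fun mcell :: "('i,'j) gen list \<Rightarrow> ('i,'j) gen list list \<Rightarrow> bool" where
  "mcell c [] \<longleftrightarrow> False"
| "mcell c (u # t) \<longleftrightarrow> nrm (c @ u) \<or> blk u \<and> mcell u t"

fun ccell :: "('i,'j) gen list \<Rightarrow> ('i,'j) gen list list \<Rightarrow> bool" where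
  "ccell c [] \<longleftrightarrow> True"
| "ccell c (u # t) \<longleftrightarrow> \<not> nrm (c @ u) \<and> blk u \<and> ccell u t"

fun mrg :: "('i,'j) gen list \<Rightarrow> ('i,'j) gen list list \<Rightarrow> ('i,'j) gen list list" where
  "mrg c [] = [c]"
| "mrg c (u # t) = (if nrm (c @ u) then (c @ u) # t else c # mrg u t)"

lemma concat_mrg: "concat (mrg c t) = c @ concat t"
  by (induction c t rule: mrg.induct) auto

lemma nrmT_mrg: "nrm c \<Longrightarrow> nrmT t \<Longrightarrow> nrmT (mrg c t)"
  by (induction c t rule: mrg.induct) (auto simp: nrmT_def)

lemma blk_prefix_unique:
  assumes "blk c" "blk c'" "c @ w = c' @ w'"
  shows "c = c'"
proof -
  obtain a j x a' j' x' where c: "c = a @ [Ad j x]" "set a \<subseteq> range Tr"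
    and c': "c' = a' @ [Ad j' x']" "set a' \<subseteq> range Tr"
    using assms(1,2) unfolding blk_def by blast
  have tw: "takeWhile (\<lambda>g. g \<in> range Tr) (b @ Ad i y # v) = b" if "set b \<subseteq> range Tr"
    for b i y and v :: "('a,'b) gen list"
    using that by (subst takeWhile_append2) auto
  have eq: "a @ Ad j x # w = a' @ Ad j' x' # w'" using assms(3) c c' by simp
  have "a = a'" using tw[OF c(2), of j x w] tw[OF c'(2), of j' x' w'] eq by simp
  then show ?thesis using eq c c' by simp
qed

text \<open>The first hypothesis lets \<open>c\<close> be recovered from any word beginning with it.
  It holds for the single letter at the start and, by \<open>blk_prefix_unique\<close>, for the
  blocks read later.\<close>

lemma mrg_inj:
  assumes "\<And>w w'. c @ w = c' @ w' \<Longrightarrow> c = c'" "mcell c t" "mcell c' t'" "mrg c t = mrg c' t'"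
    "\<forall>u\<in>set t. u \<noteq> []" "\<forall>u\<in>set t'. u \<noteq> []"
  shows "c = c' \<and> t = t'"
  using assms
proof (induction t arbitrary: c c' t')
  case (Cons u r)
  obtain u' r' where t': "t' = u' # r'" using Cons.prems(3) by (cases t') auto
  have "hd (mrg c (u # r)) = hd (mrg c' t')" using Cons.prems(4) by simp
  then have "\<exists>w w'. c @ w = c' @ w'" unfolding t' by (auto split: if_splits)
  then have c: "c' = c" using Cons.prems(1) by blast
  consider "nrm (c @ u)" "nrm (c @ u')" | "nrm (c @ u)" "\<not> nrm (c @ u')"
    | "\<not> nrm (c @ u)" "nrm (c @ u')" | "\<not> nrm (c @ u)" "\<not> nrm (c @ u')" by blast
  then show ?case
  proof cases
    case 4
    then have "blk u" "blk u'" "mcell u r" "mcell u' r'" "mrg u r = mrg u' r'"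
      using Cons.prems unfolding t' c by auto
    then have "u = u' \<and> r = r'"
      using Cons.prems(5,6) unfolding t'
      by (intro Cons.IH) (auto dest: blk_prefix_unique)
    then show ?thesis using t' c by simp
  qed (use Cons.prems in \<open>auto simp: t' c\<close>)
qed simp

lemma blk_nrm: "blk u \<Longrightarrow> nrm u" and blk_ads: "blk u \<Longrightarrow> length (ads u) = 1"
  by (auto simp: blk_def nrm_def ads_eq_Nil_iff[symmetric])

lemma split_cell_aux:
  assumes "\<not> mcell c t" "\<not> ccell c t" "length (ads c) \<le> 1" "nrmT t" "\<forall>u\<in>set t. u \<noteq> []"
  shows "\<exists>s. mcell c s \<and> mrg c s = c # t \<and> length s = Suc (length t) \<and> (\<forall>u\<in>set s. u \<noteq> [])"
  using assms
proof (induction t arbitrary: c)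
  case (Cons u r)
  have nn: "\<not> nrm (c @ u)" using Cons.prems(1) by simp
  have nu: "nrm u" using Cons.prems(4) by (simp add: nrmT_def)
  show ?case
  proof (cases "blk u")
    case True
    have "\<exists>s. mcell u s \<and> mrg u s = u # r \<and> length s = Suc (length r) \<and> (\<forall>v\<in>set s. v \<noteq> [])"
      using Cons.prems True nn blk_ads[OF True] by (intro Cons.IH) (auto simp: nrmT_def)
    then obtain s where "mcell u s" "mrg u s = u # r" "length s = Suc (length r)" "\<forall>v\<in>set s. v \<noteq> []"
      by blast
    then show ?thesis using nn True Cons.prems(5) by (intro exI[of _ "u # s"]) auto
  next
    case False
    \<comment> \<open>\<open>u\<close> is normal and \<open>c\<close> has at most one adjoint
      letter, so normality fails between that letter and the first adjoint letter of
      \<open>u\<close>.\<close>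
    obtain x where x: "ads c = [x]"
      using Cons.prems(3) nn nu by (cases "ads c") (auto simp: nrm_def)
    obtain y ys where y: "ads u = y # ys" "\<not> good x y"
      using nn nu x by (cases "ads u") (auto simp: nrm_def)
    obtain a j q where u: "u = a @ Ad j y # q" and a: "set a \<subseteq> range Tr"
      using ads_eq_ConsD[OF y(1)] by blast
    \<comment> \<open>The prefix up to the first adjoint letter is the shortest one that is not
      normal after \<open>c\<close>. Merging it with the rest \<open>q\<close> gives back the normal
      word \<open>u\<close>.\<close>
    let ?b = "a @ [Ad j y]"
    have b: "blk ?b" using a by (auto simp: blk_def)
    have "q \<noteq> []" using False b u by auto
    moreover have "\<not> nrm (c @ ?b)"
      using x y(2) a by (auto simp: nrm_def ads_eq_Nil_iff[symmetric])
    ultimately show ?thesis using nu u b Cons.prems(5)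
      by (intro exI[of _ "?b # q # r"]) auto
  qed
qed simp

text \<open>Reading starts with a single letter: a first entry of length greater than one is itself
  the result of a merge, and its partner splits off the first letter.\<close>

definition Mcell :: "('i,'j) gen list list \<Rightarrow> bool" where
  "Mcell t \<longleftrightarrow> nrmT t \<and> (\<exists>z r. t = [z] # r \<and> mcell [z] r)"

definition Ccell :: "('i,'j) gen list list \<Rightarrow> bool" where
  "Ccell t \<longleftrightarrow> nrmT t \<and> (\<exists>z r. t = [z] # r \<and> ccell [z] r)"

lemma mem_tuples_concat: "t \<in> tuples I J n \<longleftrightarrow>
   length t = n \<and> (\<forall>u\<in>set t. u \<noteq> []) \<and> set (concat t) \<subseteq> gens I J"
  unfolding tuples_def by auto

lemma split_cell:
  assumes "t \<in> tuples I J n" "1 \<le> n" "nrmT t" "\<not> Mcell t" "\<not> Ccell t"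
  obtains z r where "mcell [z] r" "mrg [z] r = t" "[z] # r \<in> tuples I J (Suc n)"
proof -
  obtain u r where t: "t = u # r" using assms(1,2) by (cases t) (auto simp: tuples_def)
  obtain z v where u: "u = z # v" using assms(1) unfolding t by (cases u) (auto simp: tuples_def)
  show ?thesis
  proof (cases "v = []")
    case False
    have "nrm u" using assms(3) by (simp add: t nrmT_def)
    then show ?thesis using that[of z "v # r"] assms(1) False by (auto simp: t u tuples_def)
  next
    case True
    have "\<exists>s. mcell [z] s \<and> mrg [z] s = [z] # r \<and> length s = Suc (length r) \<and> (\<forall>u\<in>set s. u \<noteq> [])"
      using assms True unfolding t u
      by (intro split_cell_aux) (auto simp: Mcell_def Ccell_def nrmT_def tuples_def split: gen.splits)
    then obtain s where s: "mcell [z] s" "mrg [z] s = [z] # r" "length s = Suc (length r)" "\<forall>u\<in>set s. u \<noteq> []"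
      by blast
    have "concat ([z] # s) = concat t"
      using concat_mrg[of "[z]" s] s(2) by (simp add: t u True)
    then have "[z] # s \<in> tuples I J (Suc n)"
      using assms(1) s(3,4) unfolding mem_tuples_concat by (simp add: t)
    then show ?thesis using that s t u True by blast
  qed
qed

text \<open>A merge to the left of the matched position creates a non-normal entry
  \<open>c @ u\<close>; a merge to the right leaves a shorter entry at the matched position. The
  equation for \<open>\<epsilon>\<close> encodes a sign.\<close>

lemma mcell_leading_term:
  fixes c :: "('i,'j) gen list"
  assumes "mcell c t" "\<forall>u\<in>set t. u \<noteq> []"
  shows "\<exists>\<epsilon> (L :: ('k::comm_ring_1 \<times> _) list). \<epsilon> * \<epsilon> = 1 \<and> (\<forall>g. ev (dl (c # t)) g = \<epsilon> * g (mrg c t) + ev L g)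
    \<and> (\<forall>k s. (k, s) \<in> set L \<longrightarrow> (k, s) \<in> set (dl (c # t))
        \<and> (\<not> nrmT s \<or> (map length s, map length (mrg c t)) \<in> lex less_than))"
  using assms
proof (induction t arbitrary: c)
  case (Cons u r)
  show ?case
  proof (cases "nrm (c @ u)")
    case True
    let ?L = "map (\<lambda>(k, s). (- k, c # s)) (dl (u # r)) :: ('k \<times> _) list"
    have "length c < length (c @ u)" using Cons.prems(2) by simp
    then show ?thesis using True
      by (intro exI[of _ 1] exI[of _ ?L]) (auto dest: dl_props)
  next
    case False
    then have "mcell u r" "\<forall>u\<in>set r. u \<noteq> []" using Cons.prems by auto
    from Cons.IH[OF this] obtain \<epsilon> and L :: "('k \<times> _) list" where \<epsilon>: "\<epsilon> * \<epsilon> = 1"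
      and g: "\<And>g. ev (dl (u # r)) g = \<epsilon> * g (mrg u r) + ev L g"
      and L: "\<And>k s. (k, s) \<in> set L \<Longrightarrow> (k, s) \<in> set (dl (u # r))
        \<and> (\<not> nrmT s \<or> (map length s, map length (mrg u r)) \<in> lex less_than)"
      by (elim exE conjE) blast
    let ?L = "(1, (c @ u) # r) # map (\<lambda>(k, s). (- k, c # s)) L"
    have "\<forall>g. ev (dl (c # u # r)) g = - \<epsilon> * g (mrg c (u # r)) + ev ?L g"
      using False unfolding ev_dl_Cons g by (simp add: ev_map_uminus)
    moreover have "(k, s) \<in> set (dl (c # u # r)) \<and>
        (\<not> nrmT s \<or> (map length s, map length (mrg c (u # r))) \<in> lex less_than)"
      if mem: "(k, s) \<in> set ?L" for k s
    proof (cases "s = (c @ u) # r \<and> k = 1")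
      case True
      then show ?thesis using False by (simp add: nrmT_def)
    next
      case nz: False
      then obtain s' where s: "s = c # s'" "(- k, s') \<in> set L" using mem by auto
      have "(k, s) \<in> (\<lambda>(k, s). (- k, c # s)) ` set (dl (u # r))"
        using L[OF s(2)] s(1) by (intro image_eqI[of _ _ "(- k, s')"]) auto
      then show ?thesis using L[OF s(2)] s(1) False by (auto simp: nrmT_def)
    qed
    ultimately show ?thesis using \<epsilon> by (intro exI[of _ "- \<epsilon>"] exI[of _ ?L]) simp
  qed
qed simp

section \<open>Spanning by upper partners and critical cells\<close>

lemma subsp_Bc: "subsp (Bc I J n)"
  by (simp add: Bc_def subsp_fspan)

lemma Jsp_subset_Bc: "Jsp I J n \<subseteq> Bc I J n"
  unfolding Bc_def using fspan_superset[of "Jsp I J n \<union> lin bar_d ` Bsp I J (Suc n)"] by blast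

lemma bar_d_in_Bc: "z \<in> Bsp I J (Suc n) \<Longrightarrow> lin bar_d z \<in> Bc I J n"
  unfolding Bc_def by (intro fspan_base) blast

lemma lin_bar_d_single: "lin bar_d (single t 1) = fl (dl t)"
  by (simp add: fun_eq_iff lin_eq_pair pair_single bar_d_fl)

lemma single_swap: "single a 1 b = single b 1 a"
  by (auto simp: single_def)

text \<open>Any other normal tuple is, up to sign, the leading term of the boundary of its upper
  partner, hence modulo boundaries a combination of terms covered by the induction on
  \<open>tless\<close>.\<close>

lemma generated_by_cells:
  fixes z :: "('i,'j) gen list list \<Rightarrow> 'k::field_char_0"
  assumes "1 \<le> n" "z \<in> Bsp I J n"
  shows "z \<in> fspan (Bc I J n \<union> {single t 1 | t. t \<in> tuples I J n \<and> (Mcell t \<or> Ccell t)})"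
proof -
  define V :: "(('i,'j) gen list list \<Rightarrow> 'k) set"
    where "V = fspan (Bc I J n \<union> {single t 1 | t. t \<in> tuples I J n \<and> (Mcell t \<or> Ccell t)})"
  have V: "subsp V" unfolding V_def by (rule subsp_fspan)
  have Bc: "v \<in> V" if "v \<in> Bc I J n" for v unfolding V_def by (rule fspan_base) (use that in blast)
  have "single t 1 \<in> V" if "t \<in> tuples I J n" for t
    using wf_tless that
  proof (induction t rule: wf_induct_rule)
    case (less t)
    \<comment> \<open>Such an \<open>s\<close> need not be below \<open>t\<close>, but its rewritten
      terms are, because \<open>s\<close> and \<open>t\<close> have the same concatenation.\<close>
    have nn: "single s 1 \<in> V"
      if s: "\<not> nrmT s" "s \<in> tuples I J n" "concat s = concat t" for s
    proof -
      obtain L :: "('k \<times> ('i,'j) gen list list) list"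
        where L: "\<And>c s'. (c, s') \<in> set L \<Longrightarrow> map (map ty) s' = map (map ty) s
          \<and> (map rk (concat s'), map rk (concat s)) \<in> lex less_than"
        and Js: "(\<lambda>w. single s 1 w - fl L w) \<in> Jsp I J n"
        by (rule reductionT[OF s(1)]) (rule that; use s(2) in blast)
      have "fl L \<in> V"
      proof (rule fl_in_subsp[OF V])
        fix c s' assume "(c, s') \<in> set L"
        from L[OF this] show "single s' 1 \<in> V"
          using less(1)[of s'] tuples_cong_ty[of s' s I J n] s(2,3) by (simp add: tless_iff)
      qed
      moreover have "(\<lambda>w. single s 1 w - fl L w) \<in> V" using Js Jsp_subset_Bc Bc by blast
      ultimately have "(\<lambda>w. (single s 1 w - fl L w) + fl L w) \<in> V"
        by (intro subsp_add[OF V])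
      then show ?thesis by simp
    qed
    consider "\<not> nrmT t" | "Mcell t \<or> Ccell t" | "nrmT t" "\<not> Mcell t" "\<not> Ccell t" by blast
    then show ?case
    proof cases
      case 1
      then show ?thesis using nn less.prems by blast
    next
      case 2
      then show ?thesis unfolding V_def by (intro fspan_base) (use less.prems in blast)
    next
      case 3
      obtain x r where r: "mcell [x] r" "mrg [x] r = t" and tup: "[x] # r \<in> tuples I J (Suc n)"
        using split_cell[OF less.prems assms(1) 3] .
      have "\<forall>u\<in>set r. u \<noteq> []" using tup by (simp add: tuples_def)
      from mcell_leading_term[OF r(1) this] obtain \<epsilon> and L :: "('k \<times> ('i,'j) gen list list) list"
        where \<epsilon>: "\<epsilon> * \<epsilon> = 1"
        and g: "\<And>g. ev (dl ([x] # r)) g = \<epsilon> * g t + ev L g"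
        and L: "\<And>k s. (k, s) \<in> set L \<Longrightarrow> (k, s) \<in> set (dl ([x] # r))
           \<and> (\<not> nrmT s \<or> (map length s, map length t) \<in> lex less_than)"
        unfolding r(2) by (elim exE conjE) blast
      have "fl L \<in> V"
      proof (rule fl_in_subsp[OF V])
        fix k s assume "(k, s) \<in> set L"
        note s = L[OF this]
        have stup: "s \<in> tuples I J n" using dl_tuples[OF conjunct1[OF s] tup] .
        have con: "concat s = concat t"
          using dl_props[OF conjunct1[OF s]] concat_mrg[of "[x]" r] r(2) by simp
        show "single s 1 \<in> V"
        proof (cases "nrmT s")
          case True
          then have "(s, t) \<in> tless" using s con by (simp add: tless_iff)
          then show ?thesis using less(1) stup by blast
        qed (use nn stup con in blast)
      qed
      moreover have "fl (dl ([x] # r)) \<in> V"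
        unfolding lin_bar_d_single[symmetric] by (intro Bc bar_d_in_Bc single_in_Bsp tup)
      ultimately have "(\<lambda>b. \<epsilon> * (fl (dl ([x] # r)) b - fl L b)) \<in> V"
        by (intro subsp_scale[OF V] subsp_diff[OF V])
      also have "(\<lambda>b. \<epsilon> * (fl (dl ([x] # r)) b - fl L b)) = single t 1"
        unfolding fl_def g using \<epsilon> by (simp add: fun_eq_iff single_swap[of t] mult.assoc[symmetric])
      finally show ?thesis .
    qed
  qed
  then show ?thesis unfolding V_def[symmetric] by (rule Bsp_in_subsp[OF V assms(2)])
qed

section \<open>Cycles without critical terms\<close>

lemma trans_lex_less_than: "trans (lex (less_than :: nat rel))"
  by (rule lex_transI) simp

text \<open>A nonzero coordinate at \<open>t\<close> means that \<open>t\<close> is reached from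
  \<open>s\<close> by rewriting, and every step lowers the ranks.\<close>

lemma coordT_lower:
  fixes s t :: "('i,'j) gen list list"
  assumes "coordT t s \<noteq> (0::'k::field_char_0)" "nrmT t" "\<not> nrmT s"
  shows "(map rk (concat t), map rk (concat s)) \<in> lex less_than"
proof -
  have "wf (inv_image (lex less_than) (\<lambda>s :: ('i,'j) gen list list. map rk (concat s)))"
    by (intro wf_inv_image wf_lex) simp
  then show ?thesis using assms(1,3)
  proof (induction s rule: wf_induct_rule)
    case (less s)
    obtain L :: "('k \<times> ('i,'j) gen list list) list"
      where L: "\<And>c s'. (c, s') \<in> set L \<Longrightarrow> map (map ty) s' = map (map ty) s
        \<and> (map rk (concat s'), map rk (concat s)) \<in> lex less_than"
      and g: "\<And>g. RelT g \<Longrightarrow> g s = ev L g"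
      by (rule reductionT[OF less(3)]) (rule that; blast)
    have "ev L (coordT t) \<noteq> 0" using g[OF RelT_coordT, of t] less(2) by simp
    then obtain c s' where s': "(c, s') \<in> set L" "coordT t s' \<noteq> (0::'k)"
      using ev_eq_0[of L "coordT t"] by blast
    show ?case
    proof (cases "nrmT s'")
      case True
      then have "s' = t" using s'(2) assms(2) by (simp add: coordT_normal split: if_splits)
      then show ?thesis using L[OF s'(1)] by simp
    next
      case False
      have "(map rk (concat t), map rk (concat s')) \<in> lex less_than"
        using less(1)[OF _ s'(2) False] L[OF s'(1)] by (simp add: in_inv_image)
      then show ?thesis using L[OF s'(1)] transD[OF trans_lex_less_than] by blast
    qed
  qed
qed

lemma trans_tless: "trans tless"
  unfolding tless_def by (intro trans_inv_image trans_lex_prod trans_lex_less_than)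

text \<open>Distinct upper partners have distinct leading terms. At a maximal leading term the
  coordinate of the boundary is, up to sign, the coefficient of a single cell, so that coefficient
  must vanish.\<close>

lemma cycle_of_Mcells_zero:
  fixes y :: "('i,'j) gen list list \<Rightarrow> 'k::field_char_0"
  assumes y: "y \<in> Bsp I J n" and M: "\<And>t. y t \<noteq> 0 \<Longrightarrow> Mcell t" and d: "lin bar_d y \<in> Jsp I J (n - 1)"
  shows "y = (\<lambda>_. 0)"
proof (rule ccontr)
  assume "y \<noteq> (\<lambda>_. 0)"
  define S where "S = {t. y t \<noteq> 0}"
  define m where "m t = mrg (hd t) (tl t)" for t :: "('i,'j) gen list list"
  have S: "finite S" "S \<noteq> {}" using y \<open>y \<noteq> _\<close> by (auto simp: S_def Bsp_def fin_supp_def)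
  have "\<exists>\<sigma>\<in>S. \<forall>t\<in>S. t \<noteq> \<sigma> \<longrightarrow> (m \<sigma>, m t) \<notin> tless"
    using S(1) _ _ S(2)
  proof (rule Finite_Set.bex_max_element)
    show "asymp_on S (\<lambda>t s. (m t, m s) \<in> tless)"
      using wf_asym[OF wf_tless] by (intro asymp_onI) blast
    show "transp_on S (\<lambda>t s. (m t, m s) \<in> tless)"
      using transD[OF trans_tless] by (intro transp_onI) blast
  qed
  then obtain \<sigma> where \<sigma>: "\<sigma> \<in> S" and max': "\<And>t. t \<in> S \<Longrightarrow> t \<noteq> \<sigma> \<Longrightarrow> (m \<sigma>, m t) \<notin> tless" by blast
  have max: "(m \<sigma>, m t) \<notin> tless" if "t \<in> S" for t
    using max'[OF that] wf_not_refl[OF wf_tless] by (cases "t = \<sigma>") auto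
  have cell: "\<exists>x r. t = [x] # r \<and> mcell [x] r \<and> nrmT t \<and> (\<forall>u\<in>set r. u \<noteq> [])" if "t \<in> S" for t
    using M[of t] y that by (auto simp: S_def Mcell_def Bsp_def tuples_def)
  have nm: "nrmT (m t)" if "t \<in> S" for t
  proof -
    obtain x r where "t = [x] # r" "nrmT t" using cell[OF \<open>t \<in> S\<close>] by blast
    then show ?thesis using nrmT_mrg[of "[x]" r] by (simp add: m_def nrmT_def)
  qed
  have ev: "\<exists>\<epsilon>. \<epsilon> * \<epsilon> = 1 \<and> ev (dl t) (coordT (m \<sigma>)) = (if t = \<sigma> then \<epsilon> else (0::'k))" if "t \<in> S" for t
  proof -
    obtain x r where t: "t = [x] # r" "mcell [x] r" "\<forall>u\<in>set r. u \<noteq> []" using cell[OF \<open>t \<in> S\<close>] by blast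
    have mt: "mrg [x] r = m t" by (simp add: t m_def)
    from mcell_leading_term[OF t(2,3)] obtain \<epsilon> and L :: "('k \<times> ('i,'j) gen list list) list"
      where \<epsilon>: "\<epsilon> * \<epsilon> = 1"
      and g: "\<And>g. ev (dl t) g = \<epsilon> * g (m t) + ev L g"
      and L: "\<And>k s. (k, s) \<in> set L \<Longrightarrow> (k, s) \<in> set (dl t)
         \<and> (\<not> nrmT s \<or> (map length s, map length (m t)) \<in> lex less_than)"
      unfolding mt t(1)[symmetric] by (elim exE conjE) blast
    have "ev L (coordT (m \<sigma>)) = 0"
    proof (rule ev_eq_0, rule ccontr)
      fix k s assume "(k, s) \<in> set L" and nz: "coordT (m \<sigma>) s \<noteq> (0::'k)"
      note s = L[OF this(1)]
      have con: "concat s = concat (m t)"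
        using dl_props[OF conjunct1[OF s]] by (simp add: m_def concat_mrg t)
      \<comment> \<open>A further term \<open>s\<close> with a coordinate at
        \<open>m \<sigma>\<close> is either \<open>m \<sigma>\<close> itself, with smaller lengths
        than \<open>m t\<close>, or not normal and rewritten to it. Both put
        \<open>m \<sigma>\<close> below \<open>m t\<close>, against maximality.\<close>
      have "(m \<sigma>, m t) \<in> tless"
      proof (cases "nrmT s")
        case True
        then have "s = m \<sigma>" using nz nm[OF \<sigma>] by (simp add: coordT_normal split: if_splits)
        then show ?thesis using s True con by (simp add: tless_iff)
      next
        case False
        then show ?thesis using coordT_lower[OF nz nm[OF \<sigma>]] con by (simp add: tless_iff)
      qed
      then show False using max \<open>t \<in> S\<close> by blast
    qed
    moreover have "m t = m \<sigma> \<longleftrightarrow> t = \<sigma>"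
    proof
      assume eq: "m t = m \<sigma>"
      obtain x' r' where \<sigma>': "\<sigma> = [x'] # r'" "mcell [x'] r'" "\<forall>u\<in>set r'. u \<noteq> []" using cell[OF \<sigma>] by blast
      have "[x] = [x'] \<and> r = r'"
        by (rule mrg_inj) (use t \<sigma>' eq in \<open>auto simp: m_def\<close>)
      then show "t = \<sigma>" using t \<sigma>' by simp
    qed simp
    moreover have "coordT (m \<sigma>) (m t) = (if m t = m \<sigma> then 1 else (0::'k))"
      by (rule coordT_normal) (use nm \<sigma> that in auto)
    ultimately show ?thesis using g[of "coordT (m \<sigma>)"] \<epsilon> by (intro exI[of _ \<epsilon>]) simp
  qed
  obtain \<epsilon> where \<epsilon>: "\<epsilon> * \<epsilon> = 1" "ev (dl \<sigma>) (coordT (m \<sigma>)) = (\<epsilon>::'k)" using ev[OF \<sigma>] by auto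
  have "0 = pair (lin bar_d y) (coordT (m \<sigma>))" using d RelT_coordT Jsp_subset by fastforce
  also have "\<dots> = pair y (\<lambda>t. ev (dl t) (coordT (m \<sigma>)))" by (rule pair_bar_d[OF fin_supp_Bsp[OF y]])
  also have "\<dots> = (\<Sum>t\<in>S. y t * ev (dl t) (coordT (m \<sigma>)))" by (simp add: pair_def S_def)
  also have "\<dots> = (\<Sum>t\<in>S. if t = \<sigma> then y \<sigma> * \<epsilon> else 0)"
    by (rule sum.cong[OF refl]) (use ev \<epsilon>(2) in fastforce)
  also have "\<dots> = y \<sigma> * \<epsilon>" using S(1) \<sigma> by simp
  finally have "\<epsilon> = 0" using \<sigma> by (simp add: S_def)
  then show False using \<epsilon>(1) by simp
qed

section \<open>The homology classes\<close>

text \<open>The power of s with which the letter enters exp(sF) e; the weight of the letter is 2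
  minus twice this number.\<close>

primrec dg :: "adjb \<Rightarrow> int" where
  "dg AE = 0" | "dg AH = 1" | "dg AF = 2"

abbreviation deg :: "adjb list \<Rightarrow> int" where
  "deg xs \<equiv> sum_list (map dg xs)"

definition fillL :: "(('i,'j) gen list \<times> 'j) list \<Rightarrow> adjb list \<Rightarrow> ('i,'j) gen list list" where
  "fillL sk xs = map2 fill sk xs"

lemma fillL_simps [simp]:
  "fillL [] xs = []" "fillL (s # sk) (x # xs) = fill s x # fillL sk xs"
  by (simp_all add: fillL_def)

lemma fill_inject [simp]: "fill s x = fill s y \<longleftrightarrow> x = y"
  by (cases s) simp

lemma tauL_fillL:
  fixes c :: "'k::comm_ring_1"
  shows "(c, t) \<in> set (tauL sk d) \<Longrightarrow> \<exists>xs. length xs = length sk \<and> t = fillL sk xs \<and> d = deg xs"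
proof (induction sk arbitrary: c t d)
  case (Cons s sk)
  define Q where "Q x \<longleftrightarrow> (\<exists>(k::'k) t'. t = fill s x # t' \<and> (k, t') \<in> set (tauL sk (d - dg x)))" for x
  have "Q AE \<or> Q AH \<or> Q AF" using Cons.prems by (auto simp: Q_def)
  then obtain x where "Q x" by blast
  then obtain k :: 'k and t' where t: "t = fill s x # t'" "(k, t') \<in> set (tauL sk (d - dg x))"
    by (auto simp: Q_def)
  from Cons.IH[OF t(2)] obtain xs where "length xs = length sk" "t' = fillL sk xs" "d - dg x = deg xs"
    by blast
  then show ?case using t by (intro exI[of _ "x # xs"]) simp
qed (auto split: if_splits)

text \<open>The coefficient is -1 to the number of letters h and f; squaring it avoids following the
  sign.\<close>

lemma tau_nonzero:
  assumes "length xs = length sk"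
  shows "fl (tauL sk (deg xs)) (fillL sk xs) * fl (tauL sk (deg xs)) (fillL sk xs) = (1::'k::comm_ring_1)"
  using assms
proof (induction sk arbitrary: xs)
  case Nil
  then show ?case by (simp add: fl_def single_def)
next
  case (Cons s sk)
  then obtain x ys where xs: "xs = x # ys" "length ys = length sk" by (cases xs) auto
  have "fl (tauL (s # sk) (deg xs)) (fillL (s # sk) xs)
     = (if x = AE then fl (tauL sk (deg ys)) (fillL sk ys) else - fl (tauL sk (deg ys)) (fillL sk ys) :: 'k)"
    unfolding fl_def ev_tauL_Cons xs fillL_simps ev_single_tail by (cases x) simp_all
  then show ?case using Cons.IH[OF xs(2)] by simp
qed

text \<open>After a letter other than e only f can follow, so behind h or f the tail has the largest
  possible degree. Hence equal total degrees force equal first letters.\<close>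

lemma bad_chain_unique:
  assumes "successively (\<lambda>x y. \<not> good x y) xs" "successively (\<lambda>x y. \<not> good x y) ys"
    "length xs = length ys" "deg xs = deg ys"
  shows "xs = ys"
  using assms
proof (induction xs arbitrary: ys)
  case (Cons x xs)
  obtain y ys' where ys: "ys = y # ys'" "length ys' = length xs" using Cons.prems(3) by (cases ys) auto
  have allF: "zs = replicate (length zs) AF"
    if "successively (\<lambda>x y. \<not> good x y) (z # zs)" "z \<noteq> AE" for z zs
    using that by (induction zs arbitrary: z) auto
  have degF: "deg (replicate k AF) = 2 * int k" for k by (induction k) auto
  have le: "deg zs \<le> 2 * int (length zs)" for zs
  proof (induction zs)
    case (Cons z zs) then show ?case by (cases z) auto
  qed simp
  have tail: "successively (\<lambda>x y. \<not> good x y) xs" "successively (\<lambda>x y. \<not> good x y) ys'"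
    using Cons.prems(1,2) unfolding ys by (cases xs; cases ys'; simp)+
  have Fx: "x \<noteq> AE \<Longrightarrow> deg xs = 2 * int (length xs)" using allF[OF Cons.prems(1)] degF by metis
  have Fy: "y \<noteq> AE \<Longrightarrow> deg ys' = 2 * int (length xs)"
    using allF[OF Cons.prems(2)[unfolded ys(1)]] degF ys(2) by metis
  have "x = y"
    using Cons.prems(4) Fx Fy le[of xs] le[of ys'] unfolding ys(1) ys(2)
    by (cases x; cases y) (simp_all add: ys(2))
  then show ?case using Cons.IH[OF tail] Cons.prems(4) ys by simp
qed simp

lemma cell_of_blocks: "\<forall>u\<in>set t. blk u \<Longrightarrow> mcell c t \<or> ccell c t"
  by (induction t arbitrary: c) auto

lemma not_mcell_ccell: "mcell c t \<Longrightarrow> \<not> ccell c t"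
  by (induction t arbitrary: c) auto

lemma blk_fill: "set (fst s) \<subseteq> range Tr \<Longrightarrow> blk (fill s x)"
  by (cases s) (auto simp: blk_def)

lemma blk_fillL: "trivial_sk sk \<Longrightarrow> u \<in> set (fillL sk xs) \<Longrightarrow> blk u"
  unfolding fillL_def trivial_sk_def by (fastforce intro: blk_fill dest: set_zip_leftD)

lemma nrm_fill_fill: "set (fst s) \<subseteq> range Tr \<Longrightarrow> set (fst s') \<subseteq> range Tr \<Longrightarrow>
   nrm (fill s x @ fill s' y) \<longleftrightarrow> good x y"
  by (cases s; cases s') (simp add: nrm_def ads_eq_Nil_iff[symmetric])

lemma ccell_bad_chain:
  "set (fst s) \<subseteq> range Tr \<Longrightarrow> trivial_sk sk \<Longrightarrow> length xs = length sk \<Longrightarrow> ccell (fill s x) (fillL sk xs) \<Longrightarrow>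
   successively (\<lambda>x y. \<not> good x y) (x # xs)"
proof (induction sk arbitrary: s x xs)
  case (Cons s' sk)
  obtain y ys where xs: "xs = y # ys" "length ys = length sk" using Cons.prems(3) by (cases xs) auto
  have tr: "set (fst s') \<subseteq> range Tr" "trivial_sk sk" using Cons.prems(2) by (auto simp: trivial_sk_def)
  have "\<not> good x y" "ccell (fill s' y) (fillL sk ys)"
    using Cons.prems(4) nrm_fill_fill[OF Cons.prems(1) tr(1), of x y] unfolding xs by simp_all
  then show ?case using Cons.IH[OF tr xs(2)] unfolding xs by simp
qed simp

lemma ty_fillL: "length xs = length sk \<Longrightarrow> length ys = length sk \<Longrightarrow>
   map (map ty) (fillL sk xs) = map (map ty) (fillL sk ys)"
proof (induction sk arbitrary: xs ys)
  case (Cons s sk)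
  obtain x xs' y ys' where xs: "xs = x # xs'" "ys = y # ys'" using Cons.prems by (cases xs; cases ys) auto
  show ?case using Cons.IH[of xs' ys'] Cons.prems unfolding xs by (cases s) simp
qed simp

lemma blocks_fillL:
  "\<forall>u\<in>set t. blk u \<Longrightarrow> \<exists>sk xs. trivial_sk sk \<and> length sk = length t \<and> length xs = length t \<and> t = fillL sk xs"
proof (induction t)
  case Nil
  then show ?case by (intro exI[of _ "[]"]) (simp add: trivial_sk_Nil)
next
  case (Cons u t)
  then obtain sk xs where "trivial_sk sk" "length sk = length t" "length xs = length t" "t = fillL sk xs"
    by auto
  moreover obtain a j x where "u = a @ [Ad j x]" "set a \<subseteq> range Tr" using Cons.prems by (auto simp: blk_def)
  ultimately show ?case
    by (intro exI[of _ "(a, j) # sk"] exI[of _ "x # xs"]) (simp add: trivial_sk_Cons)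
qed

lemma ccell_blk: "ccell c t \<Longrightarrow> u \<in> set t \<Longrightarrow> blk u"
  by (induction t arbitrary: c) auto

text \<open>All terms of a vector \<open>fl (tauL sk d)\<close> are chains of blocks of the same
  types and the same degree, so by \<open>bad_chain_unique\<close> only one of them is critical. The
  system relating these vectors to the critical cells is thus diagonal up to upper partners.\<close>

lemma tau_of_cell:
  fixes \<kappa> :: "('i,'j) gen list list"
  assumes "\<kappa> \<in> tuples I J n" "Ccell \<kappa>" "2 \<le> n"
  shows "\<exists>sk d. trivial_sk sk \<and> length sk = n \<and> (\<forall>e. fl (tauL sk e) \<in> (Bsp I J n :: (_ \<Rightarrow> 'k::field) set))
     \<and> fl (tauL sk d) \<kappa> \<noteq> (0::'k) \<and> (\<forall>t. fl (tauL sk d) t \<noteq> (0::'k) \<longrightarrow> t \<noteq> \<kappa> \<longrightarrow> Mcell t)"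
proof -
  obtain z r where \<kappa>: "\<kappa> = [z] # r" "ccell [z] r" using assms(2) by (auto simp: Ccell_def)
  obtain u r' where r: "r = u # r'" using assms(1,3) \<kappa>(1) by (cases r) (auto simp: tuples_def)
  \<comment> \<open>A trivial letter before the normal word \<open>u\<close> would keep it normal,
    so \<open>z\<close> is adjoint. This needs a second entry: in degree one the cell
    \<open>[[Tr i]]\<close> is critical too.\<close>
  have "\<not> nrm ([z] @ u)" "nrm u" using \<kappa>(2) blk_nrm by (auto simp: r)
  then obtain j x where z: "z = Ad j x" by (cases z) (auto simp: nrm_def)
  have "\<forall>u\<in>set r. blk u" using ccell_blk[OF \<kappa>(2)] by blast
  then obtain sk xs where sk: "trivial_sk sk" "length sk = length r" "length xs = length r" "r = fillL sk xs"
    using blocks_fillL by blast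
  let ?sk = "([], j) # sk"
  have tr: "trivial_sk ?sk" using sk(1) by (simp add: trivial_sk_Cons)
  have \<kappa>': "\<kappa> = fillL ?sk (x # xs)" using \<kappa> z sk by simp
  have len: "length (x # xs) = length ?sk" using sk by simp
  have n: "length ?sk = n" using assms(1) \<kappa> sk by (simp add: tuples_def)
  have B: "fl (tauL ?sk e) \<in> (Bsp I J n :: (_ \<Rightarrow> 'k) set)" for e
  proof (rule fl_in_subsp[OF subsp_Bsp], rule single_in_Bsp)
    fix c t assume "(c, t) \<in> set (tauL ?sk e :: ('k \<times> _) list)"
    then obtain ys where "length ys = length ?sk" "t = fillL ?sk ys" using tauL_fillL by blast
    then show "t \<in> tuples I J n"
      using tuples_cong_ty[OF ty_fillL[OF len]] assms(1) unfolding \<kappa>' by blast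
  qed
  have nz: "fl (tauL ?sk (deg (x # xs))) \<kappa> \<noteq> (0::'k)"
    using tau_nonzero[OF len, where 'k = 'k] unfolding \<kappa>' by auto
  have "Mcell t" if tnz: "fl (tauL ?sk (deg (x # xs))) t \<noteq> (0::'k)" and "t \<noteq> \<kappa>" for t
  proof -
    obtain c where "(c, t) \<in> set (tauL ?sk (deg (x # xs)) :: ('k \<times> _) list)"
      using fl_supp[OF tnz] by blast
    from tauL_fillL[OF this] obtain ys where ys: "length ys = length ?sk" "t = fillL ?sk ys" "deg (x # xs) = deg ys"
      by blast
    obtain y ys' where y: "ys = y # ys'" "length ys' = length sk" using ys(1) by (cases ys) auto
    have bl: "\<forall>u\<in>set t. blk u" using blk_fillL[OF tr] ys(2) by blast
    have t: "t = [Ad j y] # fillL sk ys'" using ys(2) y by simp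
    have "\<not> ccell [Ad j y] (fillL sk ys')"
    proof
      assume "ccell [Ad j y] (fillL sk ys')"
      then have "successively (\<lambda>x y. \<not> good x y) ys"
        using ccell_bad_chain[of "([], j)" sk ys' y] sk(1) y by simp
      moreover have "successively (\<lambda>x y. \<not> good x y) (x # xs)"
        using ccell_bad_chain[of "([], j)" sk xs x] sk \<kappa>(2) z by simp
      ultimately have "x # xs = ys" using bad_chain_unique len ys by metis
      then show False using \<open>t \<noteq> \<kappa>\<close> ys(2) \<kappa>' by simp
    qed
    moreover have "mcell [Ad j y] (fillL sk ys') \<or> ccell [Ad j y] (fillL sk ys')"
      by (rule cell_of_blocks) (use bl t in simp)
    ultimately show ?thesis using bl blk_nrm t by (auto simp: Mcell_def nrmT_def)
  qed
  then show ?thesis using tr n B nz by blast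
qed

text \<open>Each merge in e|...|e produces e a e with \<open>a\<close> trivial, which the relations
  kill. Since F commutes with the differential and multiplies by i + 1 along the string, the claim
  passes to all later terms.\<close>

lemma tauL_dl:
  assumes "trivial_sk sk" "RelT g"
  shows "ev (tauL sk d) (\<lambda>t. ev (dl t) g) = (0::'k::field_char_0)"
proof (cases "d < 0")
  case True
  then show ?thesis by (simp add: tauL_out_of_range)
next
  case False
  have "ev (tauL sk (int i)) (\<lambda>t. ev (dl t) g) = 0" for i
    using assms(2)
  proof (induction i arbitrary: g)
    case 0
    have top: "ev (tauL sk 0) h = h (fillL sk (replicate (length sk) AE))"
      for h :: "('a,'b) gen list list \<Rightarrow> 'k"
      by (induction sk arbitrary: h) (simp_all add: ev_map tauL_out_of_range)
    have "ev (dl (fillL sk (replicate (length sk) AE))) g = 0"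
      using assms(1) 0
    proof (induction sk arbitrary: g)
      case (Cons s sk)
      show ?case
      proof (cases sk)
        case (Cons s' sk')
        obtain a j a' j' where s: "s = (a, j)" "s' = (a', j')" by fastforce
        have a': "set a' \<subseteq> range Tr" using Cons.prems(1) Cons s by (simp add: trivial_sk_Cons)
        have "g ((fill s AE @ fill s' AE) # t) = 0" for t
          using RelD[OF RelTD[OF Cons.prems(2), of "[]" t] a', of a j j' "[]"]
          by (simp add: s relations_def)
        moreover have "trivial_sk sk" using Cons.prems(1) by (simp add: trivial_sk_def)
        ultimately show ?thesis
          using Cons.IH[OF _ RelT_Cons[OF Cons.prems(2)]] unfolding Cons
          by (simp only: length_Cons replicate_Suc fillL_simps ev_dl_Cons) simp
      qed simp
    qed simp
    then show ?case by (simp add: top)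
  next
    case (Suc i)
    have "of_int (int i + 1) * ev (tauL sk (int i + 1)) (\<lambda>t. ev (dl t) g)
       = ev (tauL sk (int i)) (\<lambda>t. ev (dl t) (\<lambda>s. ev (tupl SF s) g))"
      unfolding tauL_F[OF assms(1), symmetric] ev_dl_tupl ..
    also have "\<dots> = 0" by (rule Suc.IH[OF RelT_tupl[OF Suc.prems]])
    finally have "(of_nat (Suc i) :: 'k) * ev (tauL sk (int (Suc i))) (\<lambda>t. ev (dl t) g) = 0"
      by (simp add: algebra_simps)
    then show ?case unfolding mult_eq_0_iff of_nat_eq_0_iff by simp
  qed
  from this[of "nat d"] show ?thesis using False by simp
qed

section \<open>Cycles and boundaries as sl2-modules\<close>

lemma lin_add: "fin_supp u \<Longrightarrow> fin_supp v \<Longrightarrow> lin \<phi> (\<lambda>b. u b + v b) = (\<lambda>b. lin \<phi> u b + lin \<phi> v b)"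
  by (simp add: lin_eq_pair fun_eq_iff pair_add_left)

lemma lin_sum: "finite A \<Longrightarrow> (\<And>a. a \<in> A \<Longrightarrow> fin_supp (f a)) \<Longrightarrow>
   lin \<phi> (\<lambda>b. \<Sum>a\<in>A. c a * f a b) = (\<lambda>b. \<Sum>a\<in>A. c a * lin \<phi> (f a) b)"
  by (simp add: lin_eq_pair fun_eq_iff pair_sum_left)

lemma lin_fspan:
  assumes "subsp V" "\<And>v. v \<in> S \<Longrightarrow> fin_supp v \<and> lin \<phi> v \<in> V" "v \<in> fspan S"
  shows "lin \<phi> v \<in> V"
proof -
  obtain F c where F: "finite F" "F \<subseteq> S" "v = (\<lambda>b. \<Sum>u\<in>F. c u * u b)"
    using assms(3) unfolding fspan_def by auto
  have "lin \<phi> v = (\<lambda>b. \<Sum>u\<in>F. c u * lin \<phi> u b)"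
    unfolding F(3) by (rule lin_sum[OF F(1)]) (use F(2) assms(2) in blast)
  then show ?thesis using subsp_sum[OF assms(1), of F "lin \<phi>" c] F(2) assms(2) by auto
qed

lemma fspan_image_atMost:
  assumes "v \<in> fspan (w ` {..m::nat})"
  obtains c where "v = (\<lambda>b. \<Sum>i\<le>m. c i * w i b)"
proof -
  let ?V = "{v. \<exists>c. \<forall>b. v b = (\<Sum>i\<le>m. c i * w i b)}"
  have "subsp ?V" unfolding subsp_def
  proof (intro conjI ballI allI)
    show "(\<lambda>_. 0) \<in> ?V" by (intro CollectI exI[of _ "\<lambda>_. 0"]) simp
  next
    fix u v assume "u \<in> ?V" "v \<in> ?V"
    then obtain c c' where "\<forall>b. u b = (\<Sum>i\<le>m. c i * w i b)" "\<forall>b. v b = (\<Sum>i\<le>m. c' i * w i b)" by auto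
    then show "(\<lambda>b. u b + v b) \<in> ?V"
      by (intro CollectI exI[of _ "\<lambda>i. c i + c' i"]) (simp add: sum.distrib distrib_right)
  next
    fix k v assume "v \<in> ?V"
    then obtain c where "\<forall>b. v b = (\<Sum>i\<le>m. c i * w i b)" by auto
    then show "(\<lambda>b. k * v b) \<in> ?V"
      by (intro CollectI exI[of _ "\<lambda>i. k * c i"]) (simp add: sum_distrib_left mult.assoc)
  qed
  moreover have "w ` {..m} \<subseteq> ?V"
  proof clarify
    fix i assume "i \<le> m"
    then show "\<exists>c. \<forall>b. w i b = (\<Sum>l\<le>m. c l * w l b)"
      by (intro exI[of _ "\<lambda>l. if l = i then 1 else 0"]) (simp add: if_distrib[of "\<lambda>x. x * _"] sum.delta cong: if_cong)
  qed
  ultimately have "v \<in> ?V" using fspan_subset assms by (meson subsetD)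
  then obtain c where "\<forall>b. v b = (\<Sum>i\<le>m. c i * w i b)" by auto
  then show ?thesis using that[of c] by (simp add: fun_eq_iff)
qed

lemma fin_supp_Bc: "v \<in> Bc I J n \<Longrightarrow> fin_supp (v :: _ \<Rightarrow> 'k::field_char_0)"
proof -
  have "Jsp I J n \<union> lin bar_d ` Bsp I J (Suc n) \<subseteq> {z :: _ \<Rightarrow> 'k. fin_supp z}"
    using Jsp_subset[of I J n] fin_supp_bar_d by (auto simp: Bsp_def)
  then show "v \<in> Bc I J n \<Longrightarrow> fin_supp v"
    unfolding Bc_def using fspan_subset[OF subsp_fin_supp] by blast
qed

lemma Bc_stable:
  assumes "v \<in> Bc I J n"
  shows "lin (tup_act x) v \<in> (Bc I J n :: (_ \<Rightarrow> 'k::field_char_0) set)"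
proof (rule lin_fspan[OF subsp_Bc _ assms[unfolded Bc_def]])
  fix u :: "('a,'b) gen list list \<Rightarrow> 'k" assume "u \<in> Jsp I J n \<union> lin bar_d ` Bsp I J (Suc n)"
  then show "fin_supp u \<and> lin (tup_act x) u \<in> Bc I J n"
  proof
    assume u: "u \<in> Jsp I J n"
    then show ?thesis using Jsp_stable[OF u, of x] Jsp_subset_Bc[of I J n] fin_supp_Bc[of u I J n] by auto
  next
    assume "u \<in> lin bar_d ` Bsp I J (Suc n)"
    then obtain y where y: "u = lin bar_d y" "y \<in> Bsp I J (Suc n)" by blast
    have "lin (tup_act x) u = lin bar_d (lin (tup_act x) y)"
      unfolding y(1) by (rule bar_d_act[OF fin_supp_Bsp[OF y(2)], symmetric])
    then show ?thesis using bar_d_in_Bc[OF Bsp_stable[OF y(2)], of x] fin_supp_bar_d[of y] y(1) by simp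
  qed
qed

lemma subsp_Zc: "subsp (Zc I J n)"
  unfolding subsp_def Zc_def
  by (auto simp: lin_add lin_scale fin_supp_Bsp lin_def[of _ "\<lambda>_. 0"]
      intro: subsp_zero[OF subsp_Bsp] subsp_add[OF subsp_Bsp] subsp_scale[OF subsp_Bsp]
        subsp_zero[OF subsp_Jsp] subsp_add[OF subsp_Jsp] subsp_scale[OF subsp_Jsp])

lemma Bc_subset_Zc:
  assumes "1 \<le> n"
  shows "Bc I J n \<subseteq> (Zc I J n :: (_ \<Rightarrow> 'k::field_char_0) set)"
  unfolding Bc_def
proof (rule fspan_subset[OF subsp_Zc], rule subsetI)
  obtain m where n: "n = Suc m" using assms by (cases n) auto
  fix u :: "('a,'b) gen list list \<Rightarrow> 'k" assume "u \<in> Jsp I J n \<union> lin bar_d ` Bsp I J (Suc n)"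
  then show "u \<in> Zc I J n"
  proof
    assume u: "u \<in> Jsp I J n"
    then have "u \<in> Bsp I J n" using Jsp_subset by blast
    then show ?thesis using Jsp_bar_d[OF u[unfolded n]] by (simp add: Zc_def n)
  next
    assume "u \<in> lin bar_d ` Bsp I J (Suc n)"
    then obtain y where y: "u = lin bar_d y" "y \<in> Bsp I J (Suc n)" by blast
    show ?thesis using Bsp_bar_d[OF y(2)] bar_d_bar_d[OF fin_supp_Bsp[OF y(2)]] subsp_zero[OF subsp_Jsp]
      by (simp add: Zc_def y(1))
  qed
qed

lemma tau_in_Zc:
  assumes "trivial_sk sk" "1 \<le> n" "fl (tauL sk d) \<in> (Bsp I J n :: (_ \<Rightarrow> 'k::field_char_0) set)"
  shows "fl (tauL sk d) \<in> (Zc I J n :: (_ \<Rightarrow> 'k) set)"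
proof -
  obtain m where n: "n = Suc m" using assms(2) by (cases n) auto
  have "lin bar_d (fl (tauL sk d)) \<in> (Jsp I J (n - 1) :: (_ \<Rightarrow> 'k) set)"
    unfolding Jsp_eq using Bsp_bar_d[OF assms(3)[unfolded n]] tauL_dl[OF assms(1), where 'k = 'k]
    by (simp add: n pair_bar_d pair_fl)
  then show ?thesis using assms(3) by (simp add: Zc_def)
qed

section \<open>The string generated by a tensor power of e\<close>

lemma act_fl: "lin (tup_act x) (fl L) b = ev L (\<lambda>t. ev (tupl x t) (single b 1))"
  unfolding lin_fl tup_act_fl by (simp add: fl_def)

lemma tau_act:
  assumes "trivial_sk sk"
  shows "lin (tup_act SF) (fl (tauL sk d)) = (\<lambda>b. of_int (d + 1) * fl (tauL sk (d + 1)) b)"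
    "lin (tup_act SH) (fl (tauL sk d)) = (\<lambda>b. of_int (2 * int (length sk) - 2 * d) * fl (tauL sk d) b)"
    "lin (tup_act SE) (fl (tauL sk d)) = (\<lambda>b. of_int (2 * int (length sk) - d + 1) * fl (tauL sk (d - 1)) b)"
  unfolding fun_eq_iff act_fl tauL_F[OF assms] tauL_H[OF assms] tauL_E[OF assms]
  by (simp_all add: fl_def)

lemma tau_generated:
  assumes "trivial_sk sk" "subsp P" "\<And>v. v \<in> P \<Longrightarrow> lin (tup_act SF) v \<in> P" "fl (tauL sk 0) \<in> P"
  shows "fl (tauL sk d) \<in> (P :: (_ \<Rightarrow> 'k::field_char_0) set)"
proof (cases "d < 0")
  case True
  then show ?thesis using subsp_zero[OF assms(2)] by (simp add: tauL_out_of_range fl_Nil)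
next
  case False
  have "fl (tauL sk (int i)) \<in> P" for i
  proof (induction i)
    case (Suc i)
    have nz: "(of_int (int i + 1) :: 'k) \<noteq> 0" unfolding of_int_eq_0_iff by simp
    have "(\<lambda>b. inverse (of_int (int i + 1)) * (of_int (int i + 1) * fl (tauL sk (int i + 1)) b)) \<in> P"
      using assms(3)[OF Suc] unfolding tau_act(1)[OF assms(1)] by (rule subsp_scale[OF assms(2)])
    then show ?case using nz by (simp add: mult.assoc[symmetric] add.commute)
  qed (use assms(4) in simp)
  from this[of "nat d"] show ?thesis using False by simp
qed

text \<open>E lowers the top index of a nonzero combination by one, so after finitely many steps a
  nonzero multiple of the highest weight vector remains.\<close>

lemma tau_raising:
  assumes "trivial_sk sk" "subsp P" "\<And>v. v \<in> P \<Longrightarrow> lin (tup_act SE) v \<in> P"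
    and "k \<le> 2 * length sk" "(\<lambda>b. \<Sum>i\<le>k. c i * fl (tauL sk (int i)) b) \<in> P" "\<exists>i\<le>k. c i \<noteq> 0"
  shows "fl (tauL sk 0) \<in> (P :: (_ \<Rightarrow> 'k::field_char_0) set)"
  using assms(4-6)
proof (induction k arbitrary: c)
  case 0
  then have "(\<lambda>b. inverse (c 0) * (c 0 * fl (tauL sk 0) b)) \<in> P"
    by (simp add: subsp_scale[OF assms(2), of "\<lambda>b. c 0 * fl (tauL sk 0) b"])
  then show ?case using 0(3) by (simp add: mult.assoc[symmetric])
next
  case (Suc k)
  show ?case
  proof (cases "c (Suc k) = 0")
    case True
    have "\<exists>i\<le>k. c i \<noteq> 0" using Suc.prems(3) True le_Suc_eq by metis
    then show ?thesis using Suc.IH[of c] Suc.prems(1,2) True by simp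
  next
    case False
    define c' where "c' i = c (Suc i) * of_int (2 * int (length sk) - int i)" for i
    have "lin (tup_act SE) (\<lambda>b. \<Sum>i\<le>Suc k. c i * fl (tauL sk (int i)) b)
      = (\<lambda>b. \<Sum>i\<le>Suc k. c i * (of_int (2 * int (length sk) - int i + 1) * fl (tauL sk (int i - 1)) b))"
      by (subst lin_sum) (simp_all add: tau_act(3)[OF assms(1)])
    also have "\<dots> = (\<lambda>b. \<Sum>i\<le>k. c' i * fl (tauL sk (int i)) b)"
      unfolding sum.atMost_Suc_shift by (simp add: c'_def tauL_out_of_range fl_Nil mult.assoc)
    finally have "(\<lambda>b. \<Sum>i\<le>k. c' i * fl (tauL sk (int i)) b) \<in> P"
      using assms(3)[OF Suc.prems(2)] by simp
    \<comment> \<open>The new top coefficient carries the factor 2n - k with k < 2n, so it does not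
      vanish.\<close>
    moreover have "(of_int (2 * int (length sk) - int k) :: 'k) \<noteq> 0"
      unfolding of_int_eq_0_iff using Suc.prems(1) by simp
    then have "c' k \<noteq> 0" using False by (simp add: c'_def)
    ultimately show ?thesis using Suc.IH[of c'] Suc.prems(1) by auto
  qed
qed

text \<open>Modulo boundaries the string is an image of L(2n). Since its highest weight vector is
  not a boundary, \<open>tau_raising\<close> and \<open>tau_generated\<close> show that every larger
  stable subspace is everything.\<close>

lemma tau_submodule:
  fixes sk :: "(('i,'j) gen list \<times> 'j) list"
  assumes sk: "trivial_sk sk" and len: "length sk = n" and n: "2 \<le> n"
    and B: "\<And>e. fl (tauL sk e) \<in> (Bsp I J n :: (_ \<Rightarrow> 'k::field_char_0) set)"
    and nB: "fl (tauL sk 0) \<notin> (Bc I J n :: (_ \<Rightarrow> 'k) set)"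
  defines "N \<equiv> fspan (Bc I J n \<union> (\<lambda>i. fl (tauL sk (int i))) ` {..2 * n} :: (_ \<Rightarrow> 'k) set)"
  shows "irred_submod (\<lambda>x. lin (tup_act x)) (Zc I J n) (Bc I J n) N"
    and "m \<le> 2 \<Longrightarrow> \<not> submod_iso_L (\<lambda>x. lin (tup_act x)) (Zc I J n) (Bc I J n) N m"
    and "fl (tauL sk d) \<in> N"
proof -
  let ?\<tau> = "\<lambda>d. fl (tauL sk d) :: _ \<Rightarrow> 'k"
  have N: "subsp N" unfolding N_def by (rule subsp_fspan)
  have BN: "Bc I J n \<subseteq> N"
    unfolding N_def using fspan_superset[of "Bc I J n \<union> (\<lambda>i. fl (tauL sk (int i))) ` {..2 * n}"] by blast
  have \<tau>N: "?\<tau> d \<in> N" for d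
  proof (cases "0 \<le> d \<and> d \<le> 2 * int n")
    case True
    then have "?\<tau> d \<in> (\<lambda>i. fl (tauL sk (int i))) ` {..2 * n}"
      by (intro image_eqI[of _ _ "nat d"]) auto
    then show ?thesis unfolding N_def by (intro fspan_base) blast
  next
    case False
    then show ?thesis using subsp_zero[OF N] len by (auto simp: tauL_out_of_range fl_Nil)
  qed
  then show "fl (tauL sk d) \<in> N" .
  have stable: "lin (tup_act x) v \<in> N" if "v \<in> N" for x v
  proof (rule lin_fspan[OF N _ that[unfolded N_def]])
    fix u :: "('i,'j) gen list list \<Rightarrow> 'k" assume "u \<in> Bc I J n \<union> (\<lambda>i. fl (tauL sk (int i))) ` {..2 * n}"
    then show "fin_supp u \<and> lin (tup_act x) u \<in> N"
    proof
      assume "u \<in> Bc I J n"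
      then show ?thesis using Bc_stable[of u I J n x] BN fin_supp_Bc by blast
    next
      assume "u \<in> (\<lambda>i. fl (tauL sk (int i))) ` {..2 * n}"
      then obtain i where u: "u = ?\<tau> (int i)" by blast
      show ?thesis unfolding u
        by (cases x) (auto simp: tau_act[OF sk] simp del: of_int_add of_int_diff intro!: subsp_scale[OF N] \<tau>N)
    qed
  qed
  have NZ: "N \<subseteq> Zc I J n" unfolding N_def
    using Bc_subset_Zc[of n I J] tau_in_Zc[OF sk _ B] n by (intro fspan_subset[OF subsp_Zc]) auto
  have sub: "is_submod (\<lambda>x. lin (tup_act x)) (Zc I J n) (Bc I J n) N"
    unfolding is_submod_def Defs.stable_def using N stable BN NZ by blast
  have NE: "\<exists>a c. a \<in> Bc I J n \<and> v = (\<lambda>b. a b + (\<Sum>i\<le>2 * n. c i * ?\<tau> (int i) b))" if "v \<in> N" for v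
    using that unfolding N_def
    by (elim fspan_UnE[OF _ subsp_Bc] fspan_image_atMost) blast
  show "irred_submod (\<lambda>x. lin (tup_act x)) (Zc I J n) (Bc I J n) N"
    unfolding irred_submod_def
  proof (intro conjI allI impI sub)
    show "N \<noteq> Bc I J n" using \<tau>N nB by blast
    fix P assume P: "is_submod (\<lambda>x. lin (tup_act x)) (Zc I J n) (Bc I J n) P \<and> P \<subseteq> N"
    then have sP: "subsp P" and st: "\<And>x v. v \<in> P \<Longrightarrow> lin (tup_act x) v \<in> P" and BP: "Bc I J n \<subseteq> P"
      unfolding is_submod_def Defs.stable_def by blast+
    show "P = Bc I J n \<or> P = N"
    proof (cases "P \<subseteq> Bc I J n")
      case True
      then show ?thesis using BP by blast
    next
      case False
      then obtain p where p: "p \<in> P" "p \<notin> Bc I J n" by blast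
      then obtain a c where a: "a \<in> Bc I J n" and pa: "p = (\<lambda>b. a b + (\<Sum>i\<le>2 * n. c i * ?\<tau> (int i) b))"
        using NE P by blast
      have "(\<lambda>b. p b - a b) \<in> P" using subsp_diff[OF sP p(1)] a BP by blast
      then have "(\<lambda>b. \<Sum>i\<le>2 * n. c i * ?\<tau> (int i) b) \<in> P" unfolding pa by simp
      moreover have "\<exists>i\<le>2 * n. c i \<noteq> 0"
      proof (rule ccontr)
        assume "\<not> ?thesis"
        then have "p = a" unfolding pa by (simp add: fun_eq_iff)
        then show False using p(2) a by simp
      qed
      ultimately have "?\<tau> 0 \<in> P" using tau_raising[OF sk sP st, of "2 * n" c] len by simp
      then have "?\<tau> d \<in> P" for d using tau_generated[OF sk sP st] by blast
      then have "N \<subseteq> P" unfolding N_def using BP by (intro fspan_subset[OF sP]) auto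
      then show ?thesis using P by blast
    qed
  qed
  show "\<not> submod_iso_L (\<lambda>x. lin (tup_act x)) (Zc I J n) (Bc I J n) N m" if m: "m \<le> 2"
  proof
    assume "submod_iso_L (\<lambda>x. lin (tup_act x)) (Zc I J n) (Bc I J n) N m"
    then obtain w where L: "is_Lcopy (\<lambda>x. lin (tup_act x)) (Zc I J n) (Bc I J n) m w"
      and Nw: "N = fspan (Bc I J n \<union> w ` {..m})" unfolding submod_iso_L_def by blast
    have ind: "\<And>c. (\<lambda>b. \<Sum>i\<le>m. c i * w i b) \<in> Bc I J n \<Longrightarrow> \<forall>i\<le>m. c i = 0"
      and Hw: "\<And>i. i \<le> m \<Longrightarrow> (\<lambda>b. lin (tup_act SH) (w i) b - (of_nat m - 2 * of_nat i) * w i b) \<in> Bc I J n"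
      and wZ: "\<And>i. i \<le> m \<Longrightarrow> w i \<in> Zc I J n"
      using L unfolding is_Lcopy_def by blast+
    have fw: "fin_supp (w i)" if "i \<le> m" for i using wZ[OF that] by (auto simp: Zc_def Bsp_def)
    \<comment> \<open>The highest weight vector is expanded in the supposed basis of L(m). It has
      weight 2n, at least 4, while the weights m - 2i are at most 2, so all coefficients vanish and
      it would be a boundary.\<close>
    obtain a s where a: "a \<in> Bc I J n" and s: "s \<in> fspan (w ` {..m})" and \<tau>: "?\<tau> 0 = (\<lambda>b. a b + s b)"
      using \<tau>N[of 0] unfolding Nw by (elim fspan_UnE[OF _ subsp_Bc])
    obtain c where c: "s = (\<lambda>b. \<Sum>i\<le>m. c i * w i b)" using s by (rule fspan_image_atMost)
    have fs: "fin_supp s" unfolding c using subsp_sum[OF subsp_fin_supp, of "{..m}" w c] fw by auto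
    define R where "R i = (\<lambda>b. lin (tup_act SH) (w i) b - (of_nat m - 2 * of_nat i) * w i b)" for i
    have eq: "of_int (2 * int n) * (a b + s b) = lin (tup_act SH) a b + (\<Sum>i\<le>m. c i * lin (tup_act SH) (w i) b)" for b
    proof -
      have "lin (tup_act SH) (?\<tau> 0) b = of_int (2 * int n) * ?\<tau> 0 b"
        unfolding tau_act(2)[OF sk] by (simp add: len)
      moreover have "lin (tup_act SH) (?\<tau> 0) b = lin (tup_act SH) a b + lin (tup_act SH) s b"
        unfolding \<tau> lin_add[OF fin_supp_Bc[OF a] fs] ..
      moreover have "lin (tup_act SH) s b = (\<Sum>i\<le>m. c i * lin (tup_act SH) (w i) b)"
        unfolding c by (subst lin_sum) (simp_all add: fw)
      ultimately show ?thesis unfolding \<tau> by simp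
    qed
    have "(\<Sum>i\<le>m. c i * (of_nat m - 2 * of_nat i - of_int (2 * int n)) * w i b)
       = of_int (2 * int n) * a b - lin (tup_act SH) a b - (\<Sum>i\<le>m. c i * R i b)" for b
    proof -
      have "(\<Sum>i\<le>m. c i * (of_nat m - 2 * of_nat i - of_int (2 * int n)) * w i b)
        = (\<Sum>i\<le>m. c i * lin (tup_act SH) (w i) b - c i * R i b - of_int (2 * int n) * (c i * w i b))"
        by (rule sum.cong) (simp_all add: R_def algebra_simps)
      also have "\<dots> = (\<Sum>i\<le>m. c i * lin (tup_act SH) (w i) b) - (\<Sum>i\<le>m. c i * R i b) - of_int (2 * int n) * s b"
        by (simp add: sum_subtractf sum_distrib_left c)
      also have "(\<Sum>i\<le>m. c i * lin (tup_act SH) (w i) b) = of_int (2 * int n) * (a b + s b) - lin (tup_act SH) a b"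
        using eq[of b] by simp
      finally show ?thesis by (simp only: distrib_left) simp
    qed
    moreover have "(\<lambda>b. of_int (2 * int n) * a b - lin (tup_act SH) a b - (\<Sum>i\<le>m. c i * R i b)) \<in> Bc I J n"
      by (intro subsp_diff[OF subsp_Bc] subsp_scale[OF subsp_Bc] Bc_stable a subsp_sum[OF subsp_Bc])
        (use Hw in \<open>simp add: R_def\<close>)
    ultimately have z: "\<forall>i\<le>m. c i * (of_nat m - 2 * of_nat i - of_int (2 * int n)) = 0"
      by (intro ind) simp
    have "c i = 0" if "i \<le> m" for i
    proof -
      have "(of_nat m - 2 * of_nat i - of_int (2 * int n) :: 'k) = of_int (int m - 2 * int i - 2 * int n)" by simp
      also have "\<dots> \<noteq> 0" unfolding of_int_eq_0_iff using m n by simp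
      finally show ?thesis using z[rule_format, OF that] by auto
    qed
    then have "?\<tau> 0 = a" unfolding \<tau> c by (simp add: fun_eq_iff)
    then show False using a nB by simp
  qed
qed

theorem theorem4p5:
  fixes I :: "'i set" and J :: "'j set" and n :: nat
  assumes "2 \<le> n"
  shows "trunc_zero (\<lambda>x. lin (tup_act x))
           (Zc I J n :: (('i,'j) gen list list \<Rightarrow> 'k::field_char_0) set) (Bc I J n)"
  unfolding trunc_zero_def
proof
  let ?U = "\<Union> {N. irred_submod (\<lambda>x. lin (tup_act x)) (Zc I J n :: (('i,'j) gen list list \<Rightarrow> 'k) set) (Bc I J n) N
     \<and> \<not> submod_iso_L (\<lambda>x. lin (tup_act x)) (Zc I J n) (Bc I J n) N 0
     \<and> \<not> submod_iso_L (\<lambda>x. lin (tup_act x)) (Zc I J n) (Bc I J n) N 2}"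
  let ?V = "fspan (Bc I J n \<union> ?U)"
  let ?C = "{single t (1::'k) | t. t \<in> tuples I J n \<and> (Mcell t \<or> Ccell t)}"
  fix z :: "('i,'j) gen list list \<Rightarrow> 'k" assume z: "z \<in> Zc I J n"
  then have zB: "z \<in> Bsp I J n" by (simp add: Zc_def)
  have n1: "1 \<le> n" using assms by simp
  obtain b y where b: "b \<in> Bc I J n" and y: "y \<in> fspan ?C" and zby: "z = (\<lambda>t. b t + y t)"
    by (rule fspan_UnE[OF generated_by_cells[OF n1 zB] subsp_Bc])
  have yB: "y \<in> {y \<in> Bsp I J n. \<forall>t. y t \<noteq> 0 \<longrightarrow> Mcell t \<or> Ccell t}" (is "_ \<in> ?Y")
  proof -
    have "subsp ?Y" unfolding subsp_def
      by (auto intro: subsp_zero[OF subsp_Bsp] subsp_add[OF subsp_Bsp] subsp_scale[OF subsp_Bsp])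
        (metis add_0)
    moreover have "single t 1 s \<noteq> (0::'k) \<Longrightarrow> s = t" for s t :: "('i,'j) gen list list"
      by (simp add: single_def split: if_splits)
    then have "?C \<subseteq> ?Y" using single_in_Bsp by blast
    ultimately show ?thesis using y fspan_subset by blast
  qed
  define K where "K = {t. y t \<noteq> 0 \<and> Ccell t}"
  have finK: "finite K" using yB by (auto simp: K_def Bsp_def fin_supp_def intro: finite_subset)
  define good_choice where "good_choice \<kappa> p \<longleftrightarrow> (case p of (sk, d) \<Rightarrow> trivial_sk sk \<and> length sk = n
     \<and> (\<forall>e. fl (tauL sk e) \<in> (Bsp I J n :: (_ \<Rightarrow> 'k) set))
     \<and> fl (tauL sk d) \<kappa> \<noteq> (0::'k) \<and> (\<forall>t. fl (tauL sk d) t \<noteq> (0::'k) \<longrightarrow> t \<noteq> \<kappa> \<longrightarrow> Mcell t))" for \<kappa> p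
  have "\<exists>p. good_choice \<kappa> p" if "\<kappa> \<in> K" for \<kappa>
    using tau_of_cell[of \<kappa> I J n, where 'k = 'k] that yB assms by (auto simp: K_def good_choice_def Bsp_def)
  then obtain p where p: "\<And>\<kappa>. \<kappa> \<in> K \<Longrightarrow> good_choice \<kappa> (p \<kappa>)" by metis
  define T :: "('i,'j) gen list list \<Rightarrow> ('i,'j) gen list list \<Rightarrow> 'k"
    where "T \<kappa> = fl (tauL (fst (p \<kappa>)) (snd (p \<kappa>)))" for \<kappa>
  have tr: "trivial_sk (fst (p \<kappa>))" and len: "length (fst (p \<kappa>)) = n"
    and TB: "\<And>e. fl (tauL (fst (p \<kappa>)) e) \<in> (Bsp I J n :: (_ \<Rightarrow> 'k) set)"
    and nz: "T \<kappa> \<kappa> \<noteq> 0" and TM: "\<And>t. T \<kappa> t \<noteq> 0 \<Longrightarrow> t \<noteq> \<kappa> \<Longrightarrow> Mcell t" if "\<kappa> \<in> K" for \<kappa>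
    using p[OF that] by (auto simp: good_choice_def T_def split: prod.splits)
  have TZ: "T \<kappa> \<in> Zc I J n" if "\<kappa> \<in> K" for \<kappa>
    unfolding T_def by (rule tau_in_Zc[OF tr[OF that] n1 TB[OF that]])
  \<comment> \<open>If the highest weight vector is a boundary, so is its whole string; otherwise
    the string spans an irreducible submodule of the required kind.\<close>
  have TV: "T \<kappa> \<in> ?V" if \<kappa>: "\<kappa> \<in> K" for \<kappa>
  proof (cases "fl (tauL (fst (p \<kappa>)) 0) \<in> (Bc I J n :: (_ \<Rightarrow> 'k) set)")
    case True
    have "T \<kappa> \<in> Bc I J n" unfolding T_def by (rule tau_generated[OF tr[OF \<kappa>] subsp_Bc Bc_stable True])
    then show ?thesis by (intro fspan_base) blast
  next
    case False
    note sub = tau_submodule[OF tr[OF \<kappa>] len[OF \<kappa>] assms TB[OF \<kappa>] False]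
    have "T \<kappa> \<in> ?U" unfolding T_def using sub(1) sub(2)[of 0] sub(2)[of 2] sub(3) by blast
    then show ?thesis by (intro fspan_base) blast
  qed
  \<comment> \<open>The vector \<open>T \<kappa>\<close> has \<open>\<kappa>\<close> as its only
    critical term, so these coefficients make \<open>x\<close> agree with \<open>y\<close> on all
    critical cells.\<close>
  define x where "x = (\<lambda>t. \<Sum>\<kappa>\<in>K. (y \<kappa> / T \<kappa> \<kappa>) * T \<kappa> t)"
  have xZ: "x \<in> Zc I J n" unfolding x_def by (rule subsp_sum[OF subsp_Zc TZ])
  have xV: "x \<in> ?V" unfolding x_def by (rule subsp_sum[OF subsp_fspan TV])
  have MC: "\<not> (Mcell t \<and> Ccell t)" for t :: "('i,'j) gen list list"
    using not_mcell_ccell by (auto simp: Mcell_def Ccell_def)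
  have xC: "x t = y t" if t: "Ccell t" for t
  proof -
    have "x t = (\<Sum>\<kappa>\<in>K. if \<kappa> = t then y t else 0)"
      unfolding x_def
    proof (rule sum.cong[OF refl])
      fix \<kappa> assume "\<kappa> \<in> K"
      then show "(y \<kappa> / T \<kappa> \<kappa>) * T \<kappa> t = (if \<kappa> = t then y t else 0)"
        using nz[of \<kappa>] TM[of \<kappa> t] MC[of t] t by auto
    qed
    then show ?thesis using finK t by (auto simp: K_def)
  qed
  \<comment> \<open>What remains is a cycle supported on upper partners, which must be zero.\<close>
  define v where "v = (\<lambda>t. z t - b t - x t)"
  have vZ: "v \<in> Zc I J n" unfolding v_def
    using Bc_subset_Zc[OF n1] b by (intro subsp_diff[OF subsp_Zc] z xZ) blast
  have vyx: "v t = y t - x t" for t by (simp add: v_def zby)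
  have "v = (\<lambda>_. 0)"
  proof (rule cycle_of_Mcells_zero)
    show "v \<in> Bsp I J n" "lin bar_d v \<in> Jsp I J (n - 1)" using vZ by (simp_all add: Zc_def)
    fix t assume "v t \<noteq> 0"
    then have nC: "\<not> Ccell t" and "y t \<noteq> 0 \<or> x t \<noteq> 0" using vyx xC by auto
    then show "Mcell t"
    proof (elim disjE)
      assume "x t \<noteq> 0"
      then obtain \<kappa> where \<kappa>: "\<kappa> \<in> K" "T \<kappa> t \<noteq> 0"
        unfolding x_def by (metis (no_types, lifting) mult_zero_right sum.neutral)
      then have "t \<noteq> \<kappa>" using nC by (auto simp: K_def)
      then show ?thesis using TM \<kappa> by blast
    qed (use yB in blast)
  qed
  then have "z = (\<lambda>t. b t + x t)" by (simp add: v_def fun_eq_iff algebra_simps)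
  then show "z \<in> ?V" using subsp_add[OF subsp_fspan _ xV, of b] b fspan_base[of b "Bc I J n \<union> ?U"] by auto
qed

end
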